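(* Let $\Phi\subset\mathbb{R}^n$ be an irreducible crystallographic root system and let $Z_\Phi=\frac12\sum_{\alpha\in\Phi}[-\alpha,\alpha]$ be its Coxeter zonotope. Then the greatest-improvement neighbotope $\Gamma^{\mathrm{GI}}_{Z_\Phi}$ is normally equivalent to the sweep polytope $\mathrm{SP}(\mathrm{ED}(Z_\Phi))$ of the edge directions of $Z_\Phi$, equivalently to $\mathrm{SP}(\Phi)$.
   Context: A root system is a finite nonempty set $\Phi\subset\mathbb{R}^n\setminus\{0\}$ with $\Phi\cap\mathbb{R}\alpha=\{-\alpha,\alpha\}$ and $s_\alpha(\Phi)=\Phi$ for all $\alpha\in\Phi$, where $s_\alpha(x)=x-2\frac{\alpha^tx}{\alpha^t\alpha}\alpha$. It is irreducible if it has no partition into two nonempty subsets $\Phi',\Phi''$ with $\alpha^t\beta=0$ for all $\alpha\in\Phi',\beta\in\Phi''$; it is crystallographic if $\frac{2\alpha^t\beta}{\alpha^t\alpha}\in\mathbb{Z}$ for all $\alpha,\beta\in\Phi$. For a polytope $P\subset\mathbb{R}^n$ with vertex set $V(P)$ and graph $G(P)$, an arborescence on $G(P)$ is a map $\mathcal{B}:V(P)\to V(P)$ with a unique fixed point $r$, with $\mathcal{B}(v)$ adjacent to $v$ for $v\ne r$, and such that for every $v$ some iterate satisfies $\mathcal{B}^k(v)=r$. The greatest-improvement neighbotope is $$\Gamma^{\mathrm{GI}}_P=\operatorname{conv}\left\{\sum_{v\in V(P)}(\mathcal{B}(v)-v) : \mathcal{B}\text{ an arborescence of }G(P)\right\}.$$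 $\mathrm{ED}(P)=\{u-v : u,v\text{ adjacent vertices of }P\}$ (both orientations of every edge). For a finite point set $S$, the sweep polytope is the Minkowski sum $\mathrm{SP}(S)=\sum_{\{p,q\}\subseteq S,\,p\neq q}[p-q,q-p]$. A polytope $Q$ is a weak Minkowski summand of a polytope $P$ if $\lambda P=Q+R$ for some $\lambda>0$ and some polytope $R$; $P$ and $Q$ are normally equivalent if each is a weak Minkowski summand of the other. *)

theory Defs
  imports "HOL-Analysis.Analysis"
begin

(* Minkowski sums of sets are the additions (and big sums) of HOL-Library.Set_Algebras,
   which HOL-Analysis already uses; the empty sum is {0}. *)

definition root_reflection :: "'a::euclidean_space \<Rightarrow> 'a \<Rightarrow> 'a" where
  "root_reflection \<alpha> x = x - (2 * ((\<alpha> \<bullet> x) / (\<alpha> \<bullet> \<alpha>))) *\<^sub>R \<alpha>"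

definition root_system :: "'a::euclidean_space set \<Rightarrow> bool" where
  "root_system \<Phi> \<longleftrightarrow> finite \<Phi> \<and> \<Phi> \<noteq> {} \<and> 0 \<notin> \<Phi> \<and>
     (\<forall>\<alpha>\<in>\<Phi>. \<Phi> \<inter> range (\<lambda>t. t *\<^sub>R \<alpha>) = {-\<alpha>, \<alpha>} \<and> root_reflection \<alpha> ` \<Phi> = \<Phi>)"

definition irreducible_roots :: "'a::euclidean_space set \<Rightarrow> bool" where
  "irreducible_roots \<Phi> \<longleftrightarrow>
     \<not> (\<exists>\<Phi>' \<Phi>''. \<Phi>' \<noteq> {} \<and> \<Phi>'' \<noteq> {} \<and> \<Phi>' \<inter> \<Phi>'' = {} \<and> \<Phi>' \<union> \<Phi>'' = \<Phi> \<and>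
          (\<forall>\<alpha>\<in>\<Phi>'. \<forall>\<beta>\<in>\<Phi>''. \<alpha> \<bullet> \<beta> = 0))"

definition crystallographic :: "'a::euclidean_space set \<Rightarrow> bool" where
  "crystallographic \<Phi> \<longleftrightarrow> (\<forall>\<alpha>\<in>\<Phi>. \<forall>\<beta>\<in>\<Phi>. 2 * (\<alpha> \<bullet> \<beta>) / (\<alpha> \<bullet> \<alpha>) \<in> \<int>)"

definition coxeter_zonotope :: "'a::euclidean_space set \<Rightarrow> 'a set" where
  "coxeter_zonotope \<Phi> = (*\<^sub>R) (1/2) ` (\<Sum>\<alpha>\<in>\<Phi>. closed_segment (-\<alpha>) \<alpha>)"

definition vertices :: "'a::euclidean_space set \<Rightarrow> 'a set" where
  "vertices P = {v. v extreme_point_of P}"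

(* An edge is a face of affine dimension 1, so adjacent u v are distinct, and as endpoints of
   a face they are extreme points of P. *)
definition adjacent :: "'a::euclidean_space set \<Rightarrow> 'a \<Rightarrow> 'a \<Rightarrow> bool" where
  "adjacent P u v \<longleftrightarrow> closed_segment u v edge_of P"

(* The values of B outside the vertex set are arbitrary and play no role below. *)
definition arborescence :: "'a::euclidean_space set \<Rightarrow> ('a \<Rightarrow> 'a) \<Rightarrow> bool" where
  "arborescence P B \<longleftrightarrow> B \<in> vertices P \<rightarrow> vertices P \<and>
     (\<exists>r. {v \<in> vertices P. B v = v} = {r} \<and>
        (\<forall>v \<in> vertices P - {r}. adjacent P (B v) v) \<and>
        (\<forall>v \<in> vertices P. \<exists>k. (B ^^ k) v = r))"

definition GI_neighbotope :: "'a::euclidean_space set \<Rightarrow> 'a set" where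
  "GI_neighbotope P = convex hull {(\<Sum>v\<in>vertices P. B v - v) | B. arborescence P B}"

definition edge_directions :: "'a::euclidean_space set \<Rightarrow> 'a set" where
  "edge_directions P = {u - v | u v. adjacent P u v}"

(* The sum ranges over unordered pairs e = {p, q}; both orderings of e give the same segment,
   so the inner union is just that one segment. *)
definition sweep_polytope :: "'a::euclidean_space set \<Rightarrow> 'a set" where
  "sweep_polytope S =
     (\<Sum>e\<in>{{p, q} | p q. p \<in> S \<and> q \<in> S \<and> p \<noteq> q}.
        \<Union>{closed_segment (p - q) (q - p) | p q. e = {p, q}})"

(* The library's polytope predicate admits the empty set, which is excluded here for all
   three polytopes. *)
definition weak_minkowski_summand :: "'a::euclidean_space set \<Rightarrow> 'a set \<Rightarrow> bool" where
  "weak_minkowski_summand Q P \<longleftrightarrow> polytope Q \<and> Q \<noteq> {} \<and> polytope P \<and> P \<noteq> {} \<and>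
     (\<exists>c R. c > 0 \<and> polytope R \<and> R \<noteq> {} \<and> (*\<^sub>R) c ` P = Q + R)"

definition normally_equivalent :: "'a::euclidean_space set \<Rightarrow> 'a set \<Rightarrow> bool" where
  "normally_equivalent P Q \<longleftrightarrow> weak_minkowski_summand P Q \<and> weak_minkowski_summand Q P"

end

theory Submission
  imports Defs
begin

text \<open>Two polytopes are normally equivalent as soon as they have the same normal fan, and the sweep
  polytope of \<open>\<Phi>\<close> has the fan of the arrangement of all hyperplanes orthogonal to differences
  \<open>\<alpha> - \<beta>\<close> of roots. The neighbours of a vertex \<open>v\<close> of the Coxeter zonotope are the points
  \<open>v + 2 \<delta>\<close> with \<open>\<delta>\<close> in the simple system of the chamber opposite to \<open>v\<close>, so the
  greatest-improvement arborescence in direction \<open>c\<close> only depends on the order of the numbers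
  \<open>c \<bullet> \<alpha>\<close>. Conversely every such hyperplane is really crossed: if \<open>\<alpha> - \<beta>\<close> is proportional to a
  root, some vertex has a single improving direction, which changes sign there; otherwise the Cartan
  integers force \<open>\<alpha>\<close> and \<open>\<beta>\<close> (up to a common sign) to be simple in the plane they span, and some
  vertex has them as its two best directions, tied on the hyperplane.\<close>

section \<open>Perturbation and weak Minkowski summands\<close>

text \<open>The point to exclude is that the normal cone of an optimal arborescence reaches beyond
  one chamber of the difference arrangement. For generic directions optimality is decided vertex by
  vertex, so a single vertex whose choice changes is enough. The obstacle is to find it, because
  \<alpha> and \<beta> need not be simple for a common chamber. If \<alpha> \<bullet> \<beta> > 0,
  then \<alpha> - \<beta> is itself a root, so only orthogonal or obtuse pairs remain. Their plane
  may still contain a root m \<alpha> - n \<beta> with m, n > 0, which prevents simplicity.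
  Integrality shows that then \<alpha> - \<beta> is parallel to a root; a typical instance is an
  orthogonal pair of a long and a short root in G2, where \<alpha> - \<beta> is twice a short root.
  Staying at a vertex is treated as a step 0, which turns both situations into a tie between two
  steps. The factor 2 in the edges arises because \<alpha> and -\<alpha> both contribute a segment
  to the zonotope.\<close>

lemma finite_maximizer:
  fixes f :: "'a \<Rightarrow> real"
  assumes "finite V" "V \<noteq> {}"
  obtains v where "v \<in> V" "\<And>x. x \<in> V \<Longrightarrow> f x \<le> f v"
proof -
  have "Max (f ` V) \<in> f ` V" using assms by simp
  then obtain v where "v \<in> V" "f v = Max (f ` V)" by auto
  with assms(1) that show thesis by (metis Max_ge finite_imageI imageI)
qed

lemma eventually_sgn_inner_perturb:
  fixes e g :: "'a::euclidean_space"
  assumes "finite K"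
  shows "\<forall>\<^sub>F t in at_right 0. \<forall>k\<in>K. e \<bullet> k \<noteq> 0 \<longrightarrow> sgn ((e + t *\<^sub>R g) \<bullet> k) = sgn (e \<bullet> k)"
proof (intro eventually_ball_finite assms ballI)
  fix k
  have lim: "((\<lambda>t. (e + t *\<^sub>R g) \<bullet> k) \<longlongrightarrow> (e + 0 *\<^sub>R g) \<bullet> k) (at_right 0)"
    by (intro tendsto_intros)
  consider "e \<bullet> k = 0" | "e \<bullet> k > 0" | "e \<bullet> k < 0" by linarith
  then show "\<forall>\<^sub>F t in at_right 0. e \<bullet> k \<noteq> 0 \<longrightarrow> sgn ((e + t *\<^sub>R g) \<bullet> k) = sgn (e \<bullet> k)"
  proof cases
    case 2
    with order_tendstoD(1)[OF lim, of 0] show ?thesis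
      by (auto elim!: eventually_mono)
  next
    case 3
    with order_tendstoD(2)[OF lim, of 0] show ?thesis
      by (auto elim!: eventually_mono)
  qed auto
qed

lemma exists_sgn_inner_perturb:
  fixes e g :: "'a::euclidean_space"
  assumes "finite K"
  obtains t where "t > 0" "\<And>k. k \<in> K \<Longrightarrow> e \<bullet> k \<noteq> 0 \<Longrightarrow> sgn ((e + t *\<^sub>R g) \<bullet> k) = sgn (e \<bullet> k)"
proof -
  have "\<forall>\<^sub>F t in at_right (0::real). t > 0" by (simp add: eventually_at_right_less)
  with eventually_sgn_inner_perturb[OF assms, of e g]
  have "\<forall>\<^sub>F t in at_right 0. t > 0 \<and> (\<forall>k\<in>K. e \<bullet> k \<noteq> 0 \<longrightarrow> sgn ((e + t *\<^sub>R g) \<bullet> k) = sgn (e \<bullet> k))"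
    by (rule eventually_conj[rotated])
  from eventually_happens[OF this] show thesis using that by auto
qed

text \<open>A point of \<open>H\<close> can be pushed off one hyperplane at a time by a move inside
  \<open>H\<close> so small that no nonzero sign is lost. Only hyperplanes containing all of
  \<open>H\<close> cannot be avoided, hence the condition on \<open>x\<close> in the last
  clause.\<close>

lemma exists_generic_point:
  fixes e\<^sub>0 :: "'a::euclidean_space"
  assumes "subspace H" "e\<^sub>0 \<in> H" "finite K"
  shows "\<exists>e\<in>H. (\<forall>k\<in>K. e\<^sub>0 \<bullet> k \<noteq> 0 \<longrightarrow> sgn (e \<bullet> k) = sgn (e\<^sub>0 \<bullet> k)) \<and>
    (\<forall>k\<in>K. \<forall>x\<in>H. x \<bullet> k \<noteq> 0 \<longrightarrow> e \<bullet> k \<noteq> 0)"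
proof -
  \<comment> \<open>\<open>L\<close> lists the hyperplanes already avoided, while signs are
    protected on all of \<open>K\<close>; later moves therefore never undo earlier ones.\<close>
  have "\<exists>e\<in>H. (\<forall>k\<in>K. e\<^sub>0 \<bullet> k \<noteq> 0 \<longrightarrow> sgn (e \<bullet> k) = sgn (e\<^sub>0 \<bullet> k)) \<and>
      (\<forall>k\<in>L. \<forall>x\<in>H. x \<bullet> k \<noteq> 0 \<longrightarrow> e \<bullet> k \<noteq> 0)" if "L \<subseteq> K" for L
    using finite_subset[OF that \<open>finite K\<close>] that
  proof (induction L)
    case empty
    show ?case using assms(2) by auto
  next
    case (insert l L)
    then obtain e where e: "e \<in> H" "\<And>k. k \<in> K \<Longrightarrow> e\<^sub>0 \<bullet> k \<noteq> 0 \<Longrightarrow> sgn (e \<bullet> k) = sgn (e\<^sub>0 \<bullet> k)"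
      "\<And>k x. k \<in> L \<Longrightarrow> x \<in> H \<Longrightarrow> x \<bullet> k \<noteq> 0 \<Longrightarrow> e \<bullet> k \<noteq> 0" by (metis insert_subset)
    show ?case
    proof (cases "e \<bullet> l = 0 \<and> (\<exists>x\<in>H. x \<bullet> l \<noteq> 0)")
      case False
      with e show ?thesis by (intro bexI[of _ e]) auto
    next
      case True
      then obtain x where x: "x \<in> H" "x \<bullet> l \<noteq> 0" by auto
      obtain t where t: "t > 0"
        "\<And>k. k \<in> K \<Longrightarrow> e \<bullet> k \<noteq> 0 \<Longrightarrow> sgn ((e + t *\<^sub>R x) \<bullet> k) = sgn (e \<bullet> k)"
        using exists_sgn_inner_perturb[OF \<open>finite K\<close>, of e x] by metis
      show ?thesis
      proof (intro bexI[of _ "e + t *\<^sub>R x"] conjI ballI impI)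
        show "e + t *\<^sub>R x \<in> H"
          using assms(1) e(1) x(1) by (simp add: subspace_add subspace_scale)
      next
        fix k assume "k \<in> K" "e\<^sub>0 \<bullet> k \<noteq> 0"
        with e(2)[OF this] t(2)[of k] show "sgn ((e + t *\<^sub>R x) \<bullet> k) = sgn (e\<^sub>0 \<bullet> k)"
          by (metis sgn_0_0)
      next
        fix k y assume *: "k \<in> insert l L" "y \<in> H" "y \<bullet> k \<noteq> 0"
        show "(e + t *\<^sub>R x) \<bullet> k \<noteq> 0"
        proof (cases "k = l")
          case True
          with \<open>e \<bullet> l = 0 \<and> _\<close> x t(1) show ?thesis by (simp add: inner_add_left)
        next
          case False
          with * e(3)[of k y] have "e \<bullet> k \<noteq> 0" by auto
          with t(2)[of k] * False insert.prems show ?thesis by (metis insertE sgn_0_0 subsetD insert_subset)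
        qed
      qed
    qed
  qed
  from this[OF subset_refl] show ?thesis .
qed

section \<open>Support in a direction, and weak summands from normal cones\<close>

definition maximizes :: "'a::euclidean_space set \<Rightarrow> 'a \<Rightarrow> 'a \<Rightarrow> bool" where
  "maximizes P c p \<longleftrightarrow> p \<in> P \<and> (\<forall>x\<in>P. c \<bullet> x \<le> c \<bullet> p)"

lemma maximizes_hull:
  assumes "maximizes S c p"
  shows "maximizes (convex hull S) c p"
proof -
  have "convex hull S \<subseteq> {x. c \<bullet> x \<le> c \<bullet> p}"
    by (rule hull_minimal) (use assms in \<open>auto simp: maximizes_def convex_halfspace_le\<close>)
  with assms show ?thesis by (auto simp: maximizes_def hull_inc)
qed

text \<open>A point of \<open>A\<close> outside \<open>B\<close> is strictly separated from
  \<open>B\<close>, and in the direction \<open>- a\<close> it would beat every point of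
  \<open>B\<close>.\<close>

lemma subset_closed_convex_by_support:
  fixes A B :: "'a::euclidean_space set"
  assumes "convex B" "closed B" and sup: "\<And>c. \<exists>b\<in>B. \<forall>x\<in>A. c \<bullet> x \<le> c \<bullet> b"
  shows "A \<subseteq> B"
proof
  fix x assume "x \<in> A"
  show "x \<in> B"
  proof (rule ccontr)
    assume "x \<notin> B"
    then obtain a \<beta> where a: "a \<bullet> x < \<beta>" "\<forall>y\<in>B. a \<bullet> y > \<beta>"
      using separating_hyperplane_closed_point[OF assms(1,2)] by metis
    from sup[of "- a"] obtain b where "b \<in> B" "a \<bullet> b \<le> a \<bullet> x" using \<open>x \<in> A\<close> by auto
    with a show False by force
  qed
qed

lemma polytope_eq_hull_extreme:
  fixes P :: "'a::euclidean_space set"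
  assumes "polytope P"
  shows "finite {x. x extreme_point_of P}" "P = convex hull {x. x extreme_point_of P}"
  by (fact finite_polyhedron_extreme_points[OF polytope_imp_polyhedron[OF assms]]
    Krein_Milman_Minkowski[OF polytope_imp_compact[OF assms] polytope_imp_convex[OF assms]])+

text \<open>Faces of polyhedra are exposed, so some \<open>a\<close> has \<open>p\<close> as its
  only maximizer. Just finitely many extreme points compete with \<open>p\<close>, so this survives
  a small perturbation that leaves the hyperplanes orthogonal to \<open>F\<close>.\<close>

lemma extreme_point_generic_maximizer:
  fixes P :: "'a::euclidean_space set"
  assumes "polytope P" "p extreme_point_of P" "finite F" "0 \<notin> F"
  obtains c where "\<And>f. f \<in> F \<Longrightarrow> c \<bullet> f \<noteq> 0" "\<And>x. x \<in> P \<Longrightarrow> x \<noteq> p \<Longrightarrow> c \<bullet> x < c \<bullet> p"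
proof -
  let ?V = "{x. x extreme_point_of P}"
  note fin = polytope_eq_hull_extreme(1)[OF assms(1)]
  have "p \<in> P" using assms(2) by (auto simp: extreme_point_of_def)
  have "{p} exposed_face_of P"
    using assms(1,2) by (simp add: exposed_face_of_polyhedron polytope_imp_polyhedron face_of_singleton)
  then obtain a b where ab: "P \<subseteq> {x. a \<bullet> x \<le> b}" "{p} = P \<inter> {x. a \<bullet> x = b}"
    unfolding exposed_face_of_def by auto
  have pos: "a \<bullet> (p - x) > 0" if "x \<in> ?V - {p}" for x
  proof -
    have "x \<in> P" using that by (auto simp: extreme_point_of_def)
    then have "a \<bullet> x \<le> b" "a \<bullet> x \<noteq> b" using ab that by auto
    moreover have "a \<bullet> p = b" using ab by auto
    ultimately show ?thesis by (simp add: inner_diff_right)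
  qed
  define K where "K = F \<union> (\<lambda>x. p - x) ` (?V - {p})"
  have "finite K" using assms(3) fin by (simp add: K_def)
  from exists_generic_point[OF subspace_UNIV UNIV_I this, of a]
  obtain c where c: "\<And>k. k \<in> K \<Longrightarrow> a \<bullet> k \<noteq> 0 \<Longrightarrow> sgn (c \<bullet> k) = sgn (a \<bullet> k)"
    "\<And>k x. k \<in> K \<Longrightarrow> x \<bullet> k \<noteq> 0 \<Longrightarrow> c \<bullet> k \<noteq> 0" by blast
  show thesis
  proof
    fix f assume "f \<in> F"
    with assms(4) c(2)[of f f] show "c \<bullet> f \<noteq> 0" by (auto simp: K_def)
  next
    fix x assume x: "x \<in> P" "x \<noteq> p"
    have lt: "c \<bullet> y < c \<bullet> p" if "y \<in> ?V - {p}" for y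
    proof -
      have "sgn (c \<bullet> (p - y)) = sgn (a \<bullet> (p - y))"
        using that pos[OF that] by (intro c(1)) (auto simp: K_def)
      with pos[OF that] have "c \<bullet> (p - y) > 0" by (metis sgn_pos sgn_1_pos)
      then show ?thesis by (simp add: inner_diff_right)
    qed
    have sub: "convex hull (?V - {p}) \<subseteq> {y. c \<bullet> y < c \<bullet> p}"
      by (rule hull_minimal) (use lt in \<open>auto simp: convex_halfspace_lt\<close>)
    have "x \<in> convex hull (insert p (?V - {p}))"
      using x(1) polytope_eq_hull_extreme(2)[OF assms(1)] assms(2)
      by (simp add: insert_absorb)
    then show "c \<bullet> x < c \<bullet> p"
    proof (cases "?V - {p} = {}")
      case True
      then show ?thesis using \<open>x \<in> convex hull _\<close> x(2) by (simp only: True) simp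
    next
      case False
      then obtain u v y where uvy: "u \<ge> 0" "v \<ge> 0" "u + v = 1" "y \<in> convex hull (?V - {p})"
        "x = u *\<^sub>R p + v *\<^sub>R y"
        using \<open>x \<in> convex hull _\<close> unfolding convex_hull_insert[OF False] by auto
      with x(2) have "v \<noteq> 0" by auto
      have "u = 1 - v" using uvy by simp
      have "c \<bullet> y < c \<bullet> p" using sub uvy by auto
      with \<open>v \<noteq> 0\<close> uvy(2) have "v * (c \<bullet> y) < v * (c \<bullet> p)" by simp
      then show ?thesis unfolding uvy(5) \<open>u = 1 - v\<close> by (simp add: inner_add_right algebra_simps)
    qed
  qed
qed

text \<open>With \<open>q v\<close> maximal in \<open>Q\<close> on the whole normal cone of
  \<open>v\<close>, the complement is the hull of the points \<open>L *\<^sub>R v - q v\<close>. For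
  large \<open>L\<close> each of these is maximal on the same cone, so the support functions of
  \<open>Q\<close> and \<open>R\<close> add up to that of the dilate of \<open>P\<close>.\<close>

lemma weak_minkowski_summandI:
  fixes P Q :: "'a::euclidean_space set"
  assumes P: "polytope P" "P \<noteq> {}" and Q: "polytope Q" "Q \<noteq> {}"
    and q: "\<And>v. v extreme_point_of P \<Longrightarrow> \<exists>q. \<forall>c. maximizes P c v \<longrightarrow> maximizes Q c q"
  shows "weak_minkowski_summand Q P"
proof -
  define V where "V = {x. x extreme_point_of P}"
  have V: "finite V" "P = convex hull V"
    using polytope_eq_hull_extreme[OF P(1)] by (auto simp: V_def)
  from q obtain q where q: "\<And>v c. v \<in> V \<Longrightarrow> maximizes P c v \<Longrightarrow> maximizes Q c (q v)"
    unfolding V_def by (metis mem_Collect_eq)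
  have VP: "V \<subseteq> P" using V(2) by (metis hull_subset)
  have "V \<noteq> {}" using V(2) P(2) by auto
  have maxP: "maximizes P c v" if "v \<in> V" "\<And>x. x \<in> V \<Longrightarrow> c \<bullet> x \<le> c \<bullet> v" for c v
    using maximizes_hull[of V c v] that V(2) by (auto simp: maximizes_def)
  have exl: "\<exists>l\<ge>0. \<forall>c. maximizes P c v \<longrightarrow> c \<bullet> (q v - q v') \<le> l * (c \<bullet> (v - v'))"
    if vv: "v \<in> V" "v' \<in> V" for v v'
  proof -
    txt \<open>The normal cone of \<open>v\<close> is generated by the finitely many extreme points of its
      intersection with a cube; on each of these the bound holds for some \<open>l\<close>.\<close>
    define N where "N = (\<Inter>x\<in>V. {c. (v - x) \<bullet> c \<ge> 0})"
    have swap: "(v - x) \<bullet> c \<ge> 0 \<longleftrightarrow> c \<bullet> x \<le> c \<bullet> v" for x c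
      by (subst inner_commute) (simp add: inner_diff_right)
    have N: "c \<in> N \<longleftrightarrow> maximizes P c v" for c
      using maxP[OF vv(1), of c] VP vv(1) unfolding N_def INT_iff mem_Collect_eq swap
      by (auto simp: maximizes_def)
    have "polyhedron N"
      unfolding N_def by (rule polyhedron_Inter) (use V(1) in \<open>auto simp: polyhedron_halfspace_ge\<close>)
    then have "polytope (N \<inter> cbox (- One) One)"
      by (subst Int_commute) (rule polytope_Int_polyhedron[OF polytope_interval])
    then obtain X where X: "finite X" "N \<inter> cbox (- One) One = convex hull X"
      unfolding polytope_def by auto
    have XN: "maximizes P c v" if "c \<in> X" for c
      using that X(2) N hull_inc[of c X] by auto
    have "\<exists>l\<ge>0. c \<bullet> (q v - q v') \<le> l * (c \<bullet> (v - v'))" if "c \<in> X" for c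
    proof (cases "c \<bullet> (v - v') > 0")
      case True
      define l where "l = \<bar>c \<bullet> (q v - q v')\<bar> / (c \<bullet> (v - v'))"
      have "l \<ge> 0" "l * (c \<bullet> (v - v')) = \<bar>c \<bullet> (q v - q v')\<bar>" using True by (auto simp: l_def)
      then show ?thesis by (intro exI[of _ l]) auto
    next
      \<comment> \<open>No quotient is available here: \<open>v'\<close> is also maximal in
        direction \<open>c\<close>, so \<open>q v\<close> and \<open>q v'\<close> both maximize
        \<open>Q\<close> and the left side is 0.\<close>
      case False
      from XN[OF that] have m: "maximizes P c v" .
      with False VP vv have "maximizes P c v'" by (auto simp: maximizes_def inner_diff_right)
      with q[OF vv(1) m] q[OF vv(2)] have "c \<bullet> q v = c \<bullet> q v'"
        unfolding maximizes_def by (metis order_antisym)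
      moreover have "c \<bullet> v \<ge> c \<bullet> v'" using m VP vv by (auto simp: maximizes_def)
      ultimately show ?thesis by (intro exI[of _ 0]) (auto simp: inner_diff_right)
    qed
    then obtain l where l: "\<And>c. c \<in> X \<Longrightarrow> l c \<ge> 0"
      "\<And>c. c \<in> X \<Longrightarrow> c \<bullet> (q v - q v') \<le> l c * (c \<bullet> (v - v'))" by metis
    define L where "L = (\<Sum>c\<in>X. l c)"
    have "L \<ge> 0" unfolding L_def by (rule sum_nonneg) (use l in auto)
    have swap': "(q v - q v' - L *\<^sub>R (v - v')) \<bullet> c \<le> 0 \<longleftrightarrow> c \<bullet> (q v - q v') \<le> L * (c \<bullet> (v - v'))" for c
      by (subst inner_commute) (simp add: inner_diff_right)
    have "(q v - q v' - L *\<^sub>R (v - v')) \<bullet> c \<le> 0" if "c \<in> X" for c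
    proof -
      have "l c \<le> L" unfolding L_def by (rule member_le_sum) (use l X(1) that in auto)
      moreover have "c \<bullet> (v - v') \<ge> 0"
        using XN[OF that] VP vv by (auto simp: maximizes_def inner_diff_right)
      ultimately have "l c * (c \<bullet> (v - v')) \<le> L * (c \<bullet> (v - v'))" by (rule mult_right_mono)
      with l(2)[OF that] show ?thesis unfolding swap' by linarith
    qed
    then have "convex hull X \<subseteq> {c. (q v - q v' - L *\<^sub>R (v - v')) \<bullet> c \<le> 0}"
      by (intro hull_minimal) (auto simp: convex_halfspace_le)
    then have bd: "(q v - q v' - L *\<^sub>R (v - v')) \<bullet> c \<le> 0" if "c \<in> N" "c \<in> cbox (- One) One" for c
      using that X(2) by auto
    have "c \<bullet> (q v - q v') \<le> L * (c \<bullet> (v - v'))" if "maximizes P c v" for c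
    proof (cases "c = 0")
      case False
      \<comment> \<open>The bound is homogeneous in \<open>c\<close>, so rescaling into the cube
        loses nothing.\<close>
      define s where "s = inverse (norm c)"
      have "s > 0" using False by (simp add: s_def)
      have "s *\<^sub>R c \<in> N" using that N \<open>s > 0\<close> by (auto simp: maximizes_def)
      moreover have "s *\<^sub>R c \<in> cbox (- One) One"
      proof -
        have "\<bar>(s *\<^sub>R c) \<bullet> b\<bar> \<le> 1" if "b \<in> Basis" for b
          using Basis_le_norm[OF that, of "s *\<^sub>R c"] False by (simp add: s_def)
        then show ?thesis by (auto simp: mem_box abs_le_iff) 
      qed
      ultimately have "(q v - q v' - L *\<^sub>R (v - v')) \<bullet> (s *\<^sub>R c) \<le> 0" by (rule bd)
      with \<open>s > 0\<close> have "(q v - q v' - L *\<^sub>R (v - v')) \<bullet> c \<le> 0"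
        by (simp add: mult_le_0_iff)
      then show ?thesis unfolding swap' .
    qed auto
    with \<open>L \<ge> 0\<close> show ?thesis by blast
  qed
  then obtain l where l: "\<And>v v'. v \<in> V \<Longrightarrow> v' \<in> V \<Longrightarrow> l v v' \<ge> 0"
    "\<And>v v' c. v \<in> V \<Longrightarrow> v' \<in> V \<Longrightarrow> maximizes P c v \<Longrightarrow> c \<bullet> (q v - q v') \<le> l v v' * (c \<bullet> (v - v'))"
    by metis
  \<comment> \<open>The summand 1 keeps the dilation factor positive even if all bounds are
    0.\<close>
  define L where "L = 1 + (\<Sum>(v, v')\<in>V \<times> V. l v v')"
  have "L \<ge> 1" unfolding L_def by (auto intro!: sum_nonneg l(1))
  have L: "c \<bullet> (q v - q v') \<le> L * (c \<bullet> (v - v'))"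
    if "v \<in> V" "v' \<in> V" "maximizes P c v" for v v' c
  proof -
    have "l v v' \<le> (\<Sum>(v, v')\<in>V \<times> V. l v v')"
      using member_le_sum[of "(v, v')" "V \<times> V" "\<lambda>(v, v'). l v v'"] that V(1) l(1) by auto
    then have "l v v' \<le> L" by (simp add: L_def)
    moreover have "c \<bullet> (v - v') \<ge> 0"
      using that VP by (auto simp: maximizes_def inner_diff_right)
    ultimately have "l v v' * (c \<bullet> (v - v')) \<le> L * (c \<bullet> (v - v'))" by (rule mult_right_mono)
    with l(2)[OF that] show ?thesis by simp
  qed
  define R where "R = convex hull ((\<lambda>v. L *\<^sub>R v - q v) ` V)"
  have R: "polytope R" "R \<noteq> {}" using V(1) \<open>V \<noteq> {}\<close> by (auto simp: R_def polytope_convex_hull)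
  have key: "\<exists>v\<in>V. maximizes P c v \<and> maximizes Q c (q v) \<and> maximizes R c (L *\<^sub>R v - q v)" for c
  proof -
    obtain v where v: "v \<in> V" "\<And>x. x \<in> V \<Longrightarrow> c \<bullet> x \<le> c \<bullet> v"
      using finite_maximizer[OF V(1) \<open>V \<noteq> {}\<close>] by metis
    then have m: "maximizes P c v" by (intro maxP)
    have "maximizes ((\<lambda>v. L *\<^sub>R v - q v) ` V) c (L *\<^sub>R v - q v)"
      unfolding maximizes_def using L[OF v(1) _ m] v(1) by (auto simp: inner_diff_right algebra_simps)
    from maximizes_hull[OF this] m q[OF v(1) m] v(1) show ?thesis by (auto simp: R_def)
  qed
  have "(*\<^sub>R) L ` P = Q + R"
  proof (intro equalityI subset_closed_convex_by_support)
    show "convex (Q + R)" using Q R by (intro convex_set_plus polytope_imp_convex)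
    have "Q + R = (\<Union>x\<in>Q. \<Union>y\<in>R. {x + y})" by (auto simp: set_plus_def)
    then show "closed (Q + R)"
      using compact_sums'[of Q R] Q R by (simp add: polytope_imp_compact compact_imp_closed)
    show "convex ((*\<^sub>R) L ` P)" "closed ((*\<^sub>R) L ` P)"
      using P by (auto simp: convex_scaling closed_scaling polytope_imp_convex polytope_imp_closed)
  next
    fix c
    from key[of c] obtain v where v: "v \<in> V" "maximizes P c v" "maximizes Q c (q v)"
      "maximizes R c (L *\<^sub>R v - q v)" by auto
    have e: "c \<bullet> (L *\<^sub>R v) = c \<bullet> (q v + (L *\<^sub>R v - q v))" by (simp add: algebra_simps)
    show "\<exists>b\<in>Q + R. \<forall>x\<in>(*\<^sub>R) L ` P. c \<bullet> x \<le> c \<bullet> b"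
      using v \<open>L \<ge> 1\<close> by (intro bexI[of _ "q v + (L *\<^sub>R v - q v)"] set_plus_intro) (auto simp: maximizes_def)
    show "\<exists>b\<in>(*\<^sub>R) L ` P. \<forall>x\<in>Q + R. c \<bullet> x \<le> c \<bullet> b"
    proof (intro bexI[of _ "L *\<^sub>R v"] ballI)
      fix x assume "x \<in> Q + R"
      then obtain y z where "x = y + z" "y \<in> Q" "z \<in> R" by (auto elim: set_plus_elim)
      with v(3,4) show "c \<bullet> x \<le> c \<bullet> (L *\<^sub>R v)"
        unfolding e by (simp only: inner_add_right maximizes_def) (simp add: add_mono)
    qed (use v VP in auto)
  qed
  then show ?thesis
    unfolding weak_minkowski_summand_def using P Q R \<open>L \<ge> 1\<close>
    by (intro conjI exI[of _ L] exI[of _ R]) auto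
qed

section \<open>Arrangement fans and sweep polytopes\<close>

text \<open>The normal fan of \<open>P\<close> is the fan of the arrangement of the hyperplanes orthogonal to \<open>F\<close>,
  expressed through the normal cones of the vertices.\<close>

definition has_arrangement_fan :: "'a::euclidean_space set \<Rightarrow> 'a set \<Rightarrow> bool" where
  "has_arrangement_fan P F \<longleftrightarrow> (\<forall>c\<^sub>0. (\<forall>f\<in>F. c\<^sub>0 \<bullet> f \<noteq> 0) \<longrightarrow>
     (\<exists>p\<in>P. \<forall>c. maximizes P c p \<longleftrightarrow> (\<forall>f\<in>F. c\<^sub>0 \<bullet> f > 0 \<longrightarrow> c \<bullet> f \<ge> 0)))"

lemma has_arrangement_fan_scaleR:
  assumes "k > 0" "has_arrangement_fan P ((*\<^sub>R) k ` F)"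
  shows "has_arrangement_fan P F"
  using assms by (simp add: has_arrangement_fan_def zero_less_mult_iff zero_le_mult_iff)

text \<open>A vertex \<open>v\<close> of \<open>P\<close> is the only maximizer of some
  \<open>c\<^sub>0\<close> off the arrangement. Hence it is the point that the fan condition
  supplies for \<open>P\<close>, and the point supplied for \<open>Q\<close> is maximal on the same
  cone.\<close>

lemma weak_minkowski_summand_same_fan:
  fixes P Q :: "'a::euclidean_space set"
  assumes P: "polytope P" "P \<noteq> {}" "has_arrangement_fan P F"
    and Q: "polytope Q" "Q \<noteq> {}" "has_arrangement_fan Q F"
    and F: "finite F" "0 \<notin> F"
  shows "weak_minkowski_summand Q P"
proof (rule weak_minkowski_summandI[OF P(1,2) Q(1,2)])
  fix v assume v: "v extreme_point_of P"
  obtain c\<^sub>0 where c0: "\<And>f. f \<in> F \<Longrightarrow> c\<^sub>0 \<bullet> f \<noteq> 0" "\<And>x. x \<in> P \<Longrightarrow> x \<noteq> v \<Longrightarrow> c\<^sub>0 \<bullet> x < c\<^sub>0 \<bullet> v"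
    using extreme_point_generic_maximizer[OF P(1) v F] by metis
  obtain p where p: "\<And>c. maximizes P c p \<longleftrightarrow> (\<forall>f\<in>F. c\<^sub>0 \<bullet> f > 0 \<longrightarrow> c \<bullet> f \<ge> 0)"
    using P(3) c0(1) unfolding has_arrangement_fan_def by blast
  obtain q where q: "\<And>c. maximizes Q c q \<longleftrightarrow> (\<forall>f\<in>F. c\<^sub>0 \<bullet> f > 0 \<longrightarrow> c \<bullet> f \<ge> 0)"
    using Q(3) c0(1) unfolding has_arrangement_fan_def by blast
  have "v \<in> P" using v by (auto simp: extreme_point_of_def)
  moreover have "maximizes P c\<^sub>0 p" by (simp add: p)
  ultimately have "p = v" using c0(2)[of p] unfolding maximizes_def by force
  with p q show "\<exists>q. \<forall>c. maximizes P c v \<longrightarrow> maximizes Q c q" by blast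
qed

lemma normally_equivalent_same_fan:
  fixes P Q :: "'a::euclidean_space set"
  assumes "polytope P" "P \<noteq> {}" "has_arrangement_fan P F"
    and "polytope Q" "Q \<noteq> {}" "has_arrangement_fan Q F"
    and "finite F" "0 \<notin> F"
  shows "normally_equivalent P Q"
  unfolding normally_equivalent_def using assms weak_minkowski_summand_same_fan by blast

section \<open>Support points of zonotopes\<close>

definition zonotope :: "'i set \<Rightarrow> ('i \<Rightarrow> 'a::euclidean_space) \<Rightarrow> 'a set" where
  "zonotope I w = (\<Sum>i\<in>I. closed_segment (- w i) (w i))"

lemma closed_segment_uminus:
  fixes w :: "'a::real_vector"
  shows "closed_segment (- w) w = {t *\<^sub>R w | t. \<bar>t\<bar> \<le> 1}"
proof (intro equalityI subsetI)
  fix x assume "x \<in> closed_segment (- w) w"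
  then obtain u where "0 \<le> u" "u \<le> 1" "x = (1 - u) *\<^sub>R (- w) + u *\<^sub>R w"
    by (auto simp: in_segment)
  then show "x \<in> {t *\<^sub>R w | t. \<bar>t\<bar> \<le> 1}"
    by (intro CollectI exI[of _ "2 * u - 1"]) (auto simp: algebra_simps scaleR_2[symmetric] simp del: scaleR_2)
next
  fix x assume "x \<in> {t *\<^sub>R w | t. \<bar>t\<bar> \<le> 1}"
  then obtain t where "\<bar>t\<bar> \<le> 1" "x = t *\<^sub>R w" by auto
  moreover have "t *\<^sub>R w = (1 - (1 + t) / 2) *\<^sub>R (- w) + ((1 + t) / 2) *\<^sub>R w"
  proof -
    have "(1 - (1 + t) / 2) *\<^sub>R (- w) + ((1 + t) / 2) *\<^sub>R w = ((1 + t) / 2 - (1 - (1 + t) / 2)) *\<^sub>R w"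
      by (simp only: scaleR_minus_right scaleR_left_diff_distrib) simp
    also have "(1 + t) / 2 - (1 - (1 + t) / 2) = t" by (simp add: field_simps)
    finally show ?thesis ..
  qed
  ultimately show "x \<in> closed_segment (- w) w"
    unfolding in_segment by (intro exI[of _ "(1 + t) / 2"]) auto
qed

lemma zonotope_eq:
  assumes "finite I"
  shows "zonotope I w = {\<Sum>i\<in>I. t i *\<^sub>R w i | t. \<forall>i\<in>I. \<bar>t i\<bar> \<le> 1}"
proof (intro equalityI subsetI)
  fix x assume "x \<in> zonotope I w"
  then obtain s where s: "x = sum s I" "\<forall>i\<in>I. s i \<in> {t *\<^sub>R w i | t. \<bar>t\<bar> \<le> 1}"
    unfolding zonotope_def set_sum_alt[OF assms] closed_segment_uminus by auto
  then have "\<forall>i\<in>I. \<exists>t. s i = t *\<^sub>R w i \<and> \<bar>t\<bar> \<le> 1" by auto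
  then obtain t where t: "\<forall>i\<in>I. s i = t i *\<^sub>R w i \<and> \<bar>t i\<bar> \<le> 1" by metis
  with s(1) have "x = (\<Sum>i\<in>I. t i *\<^sub>R w i)" by (auto intro: sum.cong)
  with t show "x \<in> {\<Sum>i\<in>I. t i *\<^sub>R w i | t. \<forall>i\<in>I. \<bar>t i\<bar> \<le> 1}" by auto
next
  fix x assume "x \<in> {\<Sum>i\<in>I. t i *\<^sub>R w i | t. \<forall>i\<in>I. \<bar>t i\<bar> \<le> 1}"
  then obtain t where "x = (\<Sum>i\<in>I. t i *\<^sub>R w i)" "\<forall>i\<in>I. \<bar>t i\<bar> \<le> 1" by auto
  then show "x \<in> zonotope I w"
    unfolding zonotope_def set_sum_alt[OF assms] closed_segment_uminus
    by (intro CollectI exI[of _ "\<lambda>i. t i *\<^sub>R w i"]) auto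
qed

lemma polytope_zonotope:
  assumes "finite I"
  shows "polytope (zonotope I w)" "zonotope I w \<noteq> {}"
proof -
  have eq: "zonotope I w = convex hull (\<Sum>i\<in>I. {- w i, w i})"
    unfolding zonotope_def convex_hull_set_sum segment_convex_hull ..
  have "finite (\<Sum>i\<in>I. {- w i, w i})"
    using assms by (induction I) (auto simp: finite_set_plus)
  then show "polytope (zonotope I w)" unfolding eq by (rule polytope_convex_hull)
  show "zonotope I w \<noteq> {}" unfolding zonotope_eq[OF assms] by (auto intro: exI[of _ "\<lambda>_. 0"])
qed

text \<open>As \<open>sgn 0 = 0\<close>, a direction \<open>c\<close> orthogonal to some generators
  yields the centre of the face on which \<open>c\<close> is maximal; a vertex results when
  \<open>c\<close> is generic.\<close>

definition zonotope_vertex :: "'i set \<Rightarrow> ('i \<Rightarrow> 'a::euclidean_space) \<Rightarrow> 'a \<Rightarrow> 'a" where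
  "zonotope_vertex I w c = (\<Sum>i\<in>I. sgn (c \<bullet> w i) *\<^sub>R w i)"

lemma sgn_mult_self_abs: "sgn x * x = \<bar>x\<bar>" for x :: real
  by (simp add: abs_sgn mult.commute)

text \<open>The value of \<open>c\<close> is bounded term by term by the sum of all
  \<open>\<bar>c \<bullet> w i\<bar>\<close>, which is attained, so a maximizer must attain equality
  in every term.\<close>

lemma maximizes_zonotope_iff:
  assumes "finite I" "\<And>i. i \<in> I \<Longrightarrow> \<bar>t i\<bar> \<le> 1"
  shows "maximizes (zonotope I w) c (\<Sum>i\<in>I. t i *\<^sub>R w i) \<longleftrightarrow> (\<forall>i\<in>I. t i * (c \<bullet> w i) = \<bar>c \<bullet> w i\<bar>)"
proof -
  let ?M = "\<Sum>i\<in>I. \<bar>c \<bullet> w i\<bar>"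
  have val: "c \<bullet> (\<Sum>i\<in>I. s i *\<^sub>R w i) = (\<Sum>i\<in>I. s i * (c \<bullet> w i))" for s
    by (simp add: inner_sum_right)
  have term_le: "s * (c \<bullet> w i) \<le> \<bar>c \<bullet> w i\<bar>" if "\<bar>s\<bar> \<le> 1" for s i
    using mult_right_mono[OF that, of "\<bar>c \<bullet> w i\<bar>"] abs_le_D1[of "s * (c \<bullet> w i)"] by (simp add: abs_mult)
  have le: "c \<bullet> x \<le> ?M" if "x \<in> zonotope I w" for x
    using that unfolding zonotope_eq[OF assms(1)] by (auto simp: val intro!: sum_mono term_le)
  have "zonotope_vertex I w c \<in> zonotope I w"
    unfolding zonotope_eq[OF assms(1)] zonotope_vertex_def
    by (intro CollectI exI[of _ "\<lambda>i. sgn (c \<bullet> w i)"]) (simp add: abs_sgn_eq)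
  moreover have "c \<bullet> zonotope_vertex I w c = ?M"
    unfolding zonotope_vertex_def val by (simp only: sgn_mult_self_abs)
  ultimately have top: "zonotope_vertex I w c \<in> zonotope I w" "c \<bullet> zonotope_vertex I w c = ?M" .
  have mem: "(\<Sum>i\<in>I. t i *\<^sub>R w i) \<in> zonotope I w"
    unfolding zonotope_eq[OF assms(1)] using assms(2) by auto
  have "maximizes (zonotope I w) c (\<Sum>i\<in>I. t i *\<^sub>R w i) \<longleftrightarrow> (\<Sum>i\<in>I. t i * (c \<bullet> w i)) = ?M"
    unfolding maximizes_def using mem le top val[of t] by (metis order_antisym)
  also have "\<dots> \<longleftrightarrow> (\<Sum>i\<in>I. \<bar>c \<bullet> w i\<bar> - t i * (c \<bullet> w i)) = 0"
    by (auto simp: sum_subtractf)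
  also have "\<dots> \<longleftrightarrow> (\<forall>i\<in>I. \<bar>c \<bullet> w i\<bar> - t i * (c \<bullet> w i) = 0)"
    using assms by (intro sum_nonneg_eq_0_iff) (auto simp: term_le)
  finally show ?thesis by auto
qed

lemma maximizes_zonotope_vertex_iff:
  assumes "finite I"
  shows "maximizes (zonotope I w) c (zonotope_vertex I w f) \<longleftrightarrow>
    (\<forall>i\<in>I. sgn (f \<bullet> w i) * (c \<bullet> w i) = \<bar>c \<bullet> w i\<bar>)"
  unfolding zonotope_vertex_def by (rule maximizes_zonotope_iff) (auto simp: assms abs_sgn_eq)

lemma sgn_mult_eq_abs_iff:
  fixes x y :: real
  assumes "x \<noteq> 0"
  shows "sgn x * y = \<bar>y\<bar> \<longleftrightarrow> (x > 0 \<longrightarrow> y \<ge> 0) \<and> (x < 0 \<longrightarrow> y \<le> 0)"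
  using assms by (auto simp: sgn_if)

text \<open>Both signs of each generator belong to \<open>F\<close>, because
  \<open>has_arrangement_fan\<close> only looks at those \<open>f\<close> that are positive on
  \<open>c\<^sub>0\<close>.\<close>

lemma zonotope_has_arrangement_fan:
  assumes "finite I" "F = w ` I \<union> (\<lambda>i. - w i) ` I"
  shows "has_arrangement_fan (zonotope I w) F"
  unfolding has_arrangement_fan_def
proof (intro allI impI)
  fix c\<^sub>0 assume c0: "\<forall>f\<in>F. c\<^sub>0 \<bullet> f \<noteq> 0"
  have "zonotope_vertex I w c\<^sub>0 \<in> zonotope I w"
    using maximizes_zonotope_vertex_iff[OF assms(1), of w c\<^sub>0 c\<^sub>0]
    by (simp add: maximizes_def sgn_mult_self_abs)
  moreover have "maximizes (zonotope I w) c (zonotope_vertex I w c\<^sub>0) \<longleftrightarrow>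
      (\<forall>f\<in>F. c\<^sub>0 \<bullet> f > 0 \<longrightarrow> c \<bullet> f \<ge> 0)" for c
    unfolding maximizes_zonotope_vertex_iff[OF assms(1)] using c0
    unfolding assms(2) ball_Un ball_simps by (auto simp: sgn_mult_eq_abs_iff)
  ultimately show "\<exists>p\<in>zonotope I w. \<forall>c. maximizes (zonotope I w) c p \<longleftrightarrow>
      (\<forall>f\<in>F. c\<^sub>0 \<bullet> f > 0 \<longrightarrow> c \<bullet> f \<ge> 0)" by blast
qed

section \<open>Sweep polytopes as zonotopes\<close>

definition differences :: "'a::ab_group_add set \<Rightarrow> 'a set" where
  "differences S = {p - q | p q. p \<in> S \<and> q \<in> S \<and> p \<noteq> q}"

lemma finite_differences: "finite S \<Longrightarrow> finite (differences S)"
proof -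
  assume "finite S"
  have "differences S \<subseteq> (\<lambda>(p, q). p - q) ` (S \<times> S)" by (auto simp: differences_def)
  with \<open>finite S\<close> show ?thesis by (meson finite_SigmaI finite_imageI finite_subset)
qed

lemma zero_notin_differences: "0 \<notin> differences S"
  by (auto simp: differences_def)

lemma differences_scaleR:
  fixes S :: "'a::real_vector set"
  assumes "k \<noteq> 0"
  shows "differences ((*\<^sub>R) k ` S) = (*\<^sub>R) k ` differences S"
proof (intro equalityI subsetI)
  fix x assume "x \<in> differences ((*\<^sub>R) k ` S)"
  then obtain p q where "p \<in> S" "q \<in> S" "p \<noteq> q" "x = k *\<^sub>R (p - q)"
    by (auto simp: differences_def scaleR_diff_right)
  then show "x \<in> (*\<^sub>R) k ` differences S" by (auto simp: differences_def)
next
  fix x assume "x \<in> (*\<^sub>R) k ` differences S"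
  then obtain p q where "p \<in> S" "q \<in> S" "p \<noteq> q" "x = k *\<^sub>R p - k *\<^sub>R q"
    by (auto simp: differences_def scaleR_diff_right)
  moreover from this assms have "k *\<^sub>R p \<noteq> k *\<^sub>R q" by simp
  ultimately show "x \<in> differences ((*\<^sub>R) k ` S)" unfolding differences_def by blast
qed

text \<open>\<open>w e\<close> is an arbitrary orientation of the pair \<open>e\<close>. The index
  set consists of pairs and not of vectors, since distinct pairs with the same difference contribute
  separate segments.\<close>

lemma sweep_polytope_zonotope:
  fixes S :: "'a::euclidean_space set"
  assumes "finite S"
  obtains E :: "'a set set" and w where "finite E" "sweep_polytope S = zonotope E w"
    "differences S = w ` E \<union> (\<lambda>e. - w e) ` E"
proof -
  define E where "E = {{p, q} | p q. p \<in> S \<and> q \<in> S \<and> p \<noteq> q}"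
  have "E \<subseteq> Pow S" by (auto simp: E_def)
  then have "finite E" using assms by (meson finite_Pow_iff finite_subset)
  define diff_of where "diff_of e x \<longleftrightarrow> (\<exists>p q. e = {p, q} \<and> p \<in> S \<and> q \<in> S \<and> p \<noteq> q \<and> x = p - q)"
    for e :: "'a set" and x
  have "\<forall>e\<in>E. \<exists>x. diff_of e x" unfolding E_def diff_of_def by blast
  then obtain w where "\<forall>e\<in>E. diff_of e (w e)" by (rule bchoice[THEN exE])
  then have w: "\<exists>p q. e = {p, q} \<and> p \<in> S \<and> q \<in> S \<and> p \<noteq> q \<and> w e = p - q" if "e \<in> E" for e
    using that by (simp add: diff_of_def)
  have "\<Union>{closed_segment (p - q) (q - p) | p q. e = {p, q}} = closed_segment (- w e) (w e)"
    if e: "e \<in> E" for e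
  proof -
    obtain p q where pq: "e = {p, q}" "w e = p - q" using w[OF e] by blast
    have seg: "closed_segment (p - q) (q - p) = closed_segment (- w e) (w e)"
      using closed_segment_commute[of "p - q" "q - p"] by (simp add: pq(2))
    have "closed_segment (p' - q') (q' - p') = closed_segment (- w e) (w e)" if "e = {p', q'}" for p' q'
    proof -
      from that pq(1) consider "p' = p" "q' = q" | "p' = q" "q' = p" by (auto simp: doubleton_eq_iff)
      then show ?thesis
        by cases (use seg closed_segment_commute[of "p - q" "q - p"] in simp_all)
    qed
    then have "{closed_segment (p - q) (q - p) | p q. e = {p, q}} \<subseteq> {closed_segment (- w e) (w e)}"
      by blast
    moreover have "closed_segment (- w e) (w e) \<in> {closed_segment (p - q) (q - p) | p q. e = {p, q}}"
      using seg pq(1) by blast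
    ultimately have "{closed_segment (p - q) (q - p) | p q. e = {p, q}} = {closed_segment (- w e) (w e)}"
      by blast
    then show ?thesis by (simp only: cSup_singleton)
  qed
  then have "sweep_polytope S = zonotope E w"
    unfolding sweep_polytope_def zonotope_def E_def[symmetric] by (rule sum.cong[OF refl])
  moreover have "differences S = w ` E \<union> (\<lambda>e. - w e) ` E"
  proof (intro equalityI subsetI)
    fix x assume "x \<in> differences S"
    then obtain p q where pq: "p \<in> S" "q \<in> S" "p \<noteq> q" "x = p - q" by (auto simp: differences_def)
    then have "{p, q} \<in> E" by (auto simp: E_def)
    from w[OF this] obtain p' q' where p'q': "{p, q} = {p', q'}" "w {p, q} = p' - q'" by blast
    from p'q'(1) consider "p' = p" "q' = q" | "p' = q" "q' = p" by (auto simp: doubleton_eq_iff)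
    then have "x = w {p, q} \<or> x = - w {p, q}" by cases (simp_all add: pq(4) p'q'(2))
    with \<open>{p, q} \<in> E\<close> show "x \<in> w ` E \<union> (\<lambda>e. - w e) ` E" by blast
  next
    fix x assume "x \<in> w ` E \<union> (\<lambda>e. - w e) ` E"
    then obtain e where e: "e \<in> E" "x = w e \<or> x = - w e" by auto
    obtain p q where "p \<in> S" "q \<in> S" "p \<noteq> q" "w e = p - q" using w[OF e(1)] by blast
    moreover from this e(2) have "x = p - q \<or> x = q - p" by auto
    ultimately show "x \<in> differences S" by (auto simp: differences_def)
  qed
  ultimately show thesis using that \<open>finite E\<close> by blast
qed

lemma sweep_polytope_fan:
  fixes S :: "'a::euclidean_space set"
  assumes "finite S"
  shows "polytope (sweep_polytope S)" "sweep_polytope S \<noteq> {}"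
    "has_arrangement_fan (sweep_polytope S) (differences S)"
proof -
  obtain E :: "'a set set" and w where "finite E" "sweep_polytope S = zonotope E w"
    "differences S = w ` E \<union> (\<lambda>e. - w e) ` E"
    using sweep_polytope_zonotope[OF assms] by metis
  then show "polytope (sweep_polytope S)" "sweep_polytope S \<noteq> {}"
    "has_arrangement_fan (sweep_polytope S) (differences S)"
    by (auto simp: polytope_zonotope zonotope_has_arrangement_fan)
qed

section \<open>Faces of the Coxeter zonotope\<close>

lemma mult_eq_abs_imp_sgn:
  fixes x :: real
  assumes "t * x = \<bar>x\<bar>" "x \<noteq> 0"
  shows "t = sgn x"
  using assms by (metis abs_sgn mult.commute mult_right_cancel)

lemma set_plus_scaleR: "(*\<^sub>R) k ` A + (*\<^sub>R) k ` B = (*\<^sub>R) k ` (A + B)" for A B :: "'a::real_vector set"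
proof (intro equalityI subsetI)
  fix x assume "x \<in> (*\<^sub>R) k ` A + (*\<^sub>R) k ` B"
  then obtain a b where ab: "a \<in> A" "b \<in> B" "x = k *\<^sub>R a + k *\<^sub>R b"
    by (auto elim!: set_plus_elim)
  have "x = k *\<^sub>R (a + b)" unfolding ab(3) by (rule scaleR_add_right[symmetric])
  with set_plus_intro[OF ab(1,2)] show "x \<in> (*\<^sub>R) k ` (A + B)" by blast
next
  fix x assume "x \<in> (*\<^sub>R) k ` (A + B)"
  then obtain a b where ab: "a \<in> A" "b \<in> B" "x = k *\<^sub>R (a + b)"
    by (auto elim!: set_plus_elim)
  have "x = k *\<^sub>R a + k *\<^sub>R b" unfolding ab(3) by (rule scaleR_add_right)
  with ab(1,2) show "x \<in> (*\<^sub>R) k ` A + (*\<^sub>R) k ` B" by auto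
qed

section \<open>Reflections and Cartan integers\<close>

locale crystallographic_roots =
  fixes \<Phi> :: "'a::euclidean_space set"
  assumes root_system: "root_system \<Phi>" and crystallographic: "crystallographic \<Phi>"
begin

lemma finite_roots: "finite \<Phi>"
  using root_system by (simp add: root_system_def)

lemma root_nonzero: "\<alpha> \<in> \<Phi> \<Longrightarrow> \<alpha> \<noteq> 0"
  using root_system by (auto simp: root_system_def)

lemma uminus_root: "\<alpha> \<in> \<Phi> \<Longrightarrow> - \<alpha> \<in> \<Phi>"
  using root_system by (auto simp: root_system_def)

lemma root_neq_uminus: "\<alpha> \<in> \<Phi> \<Longrightarrow> \<alpha> \<noteq> - \<alpha>"
  using root_nonzero[of \<alpha>] scaleR_2[of \<alpha>] by (auto simp: eq_neg_iff_add_eq_0)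

lemma parallel_root:
  assumes "\<alpha> \<in> \<Phi>" "t *\<^sub>R \<alpha> \<in> \<Phi>"
  shows "t = 1 \<or> t = -1"
proof -
  have "t *\<^sub>R \<alpha> \<in> \<Phi> \<inter> range (\<lambda>t. t *\<^sub>R \<alpha>)" using assms(2) by auto
  then have "t *\<^sub>R \<alpha> = 1 *\<^sub>R \<alpha> \<or> t *\<^sub>R \<alpha> = (-1) *\<^sub>R \<alpha>"
    using root_system assms(1) by (auto simp: root_system_def)
  then show ?thesis using root_nonzero[OF assms(1)] by (metis scaleR_cancel_right)
qed

definition cartan :: "'a \<Rightarrow> 'a \<Rightarrow> real" where
  "cartan \<alpha> \<beta> = 2 * (\<alpha> \<bullet> \<beta>) / (\<alpha> \<bullet> \<alpha>)"

lemma cartan_Ints: "\<alpha> \<in> \<Phi> \<Longrightarrow> \<beta> \<in> \<Phi> \<Longrightarrow> cartan \<alpha> \<beta> \<in> \<int>"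
  using crystallographic by (auto simp: crystallographic_def cartan_def)

lemma reflection_root:
  assumes "\<alpha> \<in> \<Phi>" "\<beta> \<in> \<Phi>"
  shows "\<beta> - cartan \<alpha> \<beta> *\<^sub>R \<alpha> \<in> \<Phi>"
proof -
  have "root_reflection \<alpha> \<beta> \<in> \<Phi>" using root_system assms by (auto simp: root_system_def)
  then show ?thesis by (simp add: root_reflection_def cartan_def)
qed

lemma strict_Cauchy_Schwarz_roots:
  assumes "\<alpha> \<in> \<Phi>" "\<beta> \<in> \<Phi>" "\<beta> \<noteq> \<alpha>" "\<beta> \<noteq> - \<alpha>"
  shows "(\<alpha> \<bullet> \<beta>) * (\<alpha> \<bullet> \<beta>) < (\<alpha> \<bullet> \<alpha>) * (\<beta> \<bullet> \<beta>)"
proof -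
  define t where "t = (\<alpha> \<bullet> \<beta>) / (\<alpha> \<bullet> \<alpha>)"
  have aa: "\<alpha> \<bullet> \<alpha> > 0" using root_nonzero[OF assms(1)] by simp
  have "\<beta> \<noteq> t *\<^sub>R \<alpha>" using parallel_root[OF assms(1), of t] assms by auto
  then have "(\<beta> - t *\<^sub>R \<alpha>) \<bullet> (\<beta> - t *\<^sub>R \<alpha>) > 0" by simp
  also have "(\<beta> - t *\<^sub>R \<alpha>) \<bullet> (\<beta> - t *\<^sub>R \<alpha>) = \<beta> \<bullet> \<beta> - t * (\<alpha> \<bullet> \<beta>)"
    using aa by (simp add: inner_diff_left inner_diff_right inner_commute t_def)
  finally have "(\<alpha> \<bullet> \<alpha>) * (t * (\<alpha> \<bullet> \<beta>)) < (\<alpha> \<bullet> \<alpha>) * (\<beta> \<bullet> \<beta>)" using aa by simp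
  then show ?thesis using aa by (simp add: t_def)
qed

text \<open>The product is 4 cos^2 of the angle between the two roots, and these are not
  parallel.\<close>

lemma cartan_mult_less:
  assumes "\<alpha> \<in> \<Phi>" "\<beta> \<in> \<Phi>" "\<beta> \<noteq> \<alpha>" "\<beta> \<noteq> - \<alpha>"
  shows "cartan \<alpha> \<beta> * cartan \<beta> \<alpha> < 4"
proof -
  have "(\<alpha> \<bullet> \<alpha>) * (\<beta> \<bullet> \<beta>) > 0" using assms(1,2) root_nonzero by simp
  then show ?thesis using strict_Cauchy_Schwarz_roots[OF assms]
    by (simp add: cartan_def inner_commute[of \<beta> \<alpha>] divide_simps mult_ac)
qed

text \<open>Two positive Cartan integers with product below 4 cannot both be at least 2. If one of
  them is 1, the corresponding reflection produces the difference up to sign.\<close>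

lemma diff_root:
  assumes "\<alpha> \<in> \<Phi>" "\<beta> \<in> \<Phi>" "\<alpha> \<noteq> \<beta>" "\<alpha> \<bullet> \<beta> > 0"
  shows "\<alpha> - \<beta> \<in> \<Phi>"
proof -
  have ne: "\<beta> \<noteq> - \<alpha>"
  proof
    assume "\<beta> = - \<alpha>"
    then have "\<alpha> \<bullet> \<beta> = - (\<alpha> \<bullet> \<alpha>)" by simp
    with assms(4) inner_ge_zero[of \<alpha>] show False by linarith
  qed
  obtain m n :: int where mn: "cartan \<alpha> \<beta> = of_int m" "cartan \<beta> \<alpha> = of_int n"
    using cartan_Ints assms(1,2) by (metis Ints_cases)
  have "cartan \<alpha> \<beta> > 0" "cartan \<beta> \<alpha> > 0"
    using assms root_nonzero by (auto simp: cartan_def inner_commute)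
  then have "m > 0" "n > 0" using mn by auto
  have "of_int (m * n) < (4 :: real)" using cartan_mult_less[OF assms(1,2) _ ne] assms(3) mn by auto
  then have "m * n < 4" by linarith
  have "m = 1 \<or> n = 1"
  proof (rule ccontr)
    assume "\<not> ?thesis"
    with \<open>m > 0\<close> \<open>n > 0\<close> have "2 \<le> m" "2 \<le> n" by auto
    then have "2 * 2 \<le> m * n" by (intro mult_mono) auto
    with \<open>m * n < 4\<close> show False by simp
  qed
  then show ?thesis
  proof
    assume "m = 1"
    with reflection_root[OF assms(1,2)] mn have "\<beta> - \<alpha> \<in> \<Phi>" by simp
    from uminus_root[OF this] show ?thesis by simp
  next
    assume "n = 1"
    with reflection_root[OF assms(2,1)] mn show ?thesis by simp
  qed
qed

text \<open>Moving along an edge in direction \<gamma> only affects the terms of \<gamma> and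
  -\<gamma>, so these are isolated.\<close>

lemma sum_roots_split:
  assumes "\<gamma> \<in> \<Phi>"
  shows "sum h \<Phi> = h \<gamma> + h (- \<gamma>) + sum h (\<Phi> - {\<gamma>, - \<gamma>})"
proof -
  have "\<gamma> \<noteq> - \<gamma>" using root_neq_uminus[OF assms] .
  have "sum h \<Phi> = sum h (\<Phi> - {\<gamma>, - \<gamma>}) + sum h {\<gamma>, - \<gamma>}"
    using assms uminus_root finite_roots by (intro sum.subset_diff) auto
  then show ?thesis using \<open>\<gamma> \<noteq> - \<gamma>\<close> by (simp add: add_ac)
qed

section \<open>Vertices and edges of the Coxeter zonotope\<close>

abbreviation "Z \<equiv> coxeter_zonotope \<Phi>"

lemma coxeter_zonotope_eq: "Z = zonotope \<Phi> (\<lambda>\<alpha>. (1/2) *\<^sub>R \<alpha>)"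
proof -
  have "(*\<^sub>R) (1/2) ` (\<Sum>\<alpha>\<in>\<Phi>. closed_segment (-\<alpha>) \<alpha>) =
      sum ((`) ((*\<^sub>R) (1/2)) \<circ> (\<lambda>\<alpha>. closed_segment (-\<alpha>) \<alpha>)) \<Phi>"
    by (rule sum_set_linear) (simp_all add: set_plus_scaleR)
  also have "\<dots> = zonotope \<Phi> (\<lambda>\<alpha>. (1/2) *\<^sub>R \<alpha>)"
    unfolding zonotope_def
  proof (rule sum.cong[OF refl])
    fix \<alpha> :: 'a
    have "linear ((*\<^sub>R) (1/2 :: real) :: 'a \<Rightarrow> 'a)" by (rule linear_scaleR)
    from closed_segment_linear_image[OF this, of "- \<alpha>" \<alpha>]
    show "((`) ((*\<^sub>R) (1/2)) \<circ> (\<lambda>\<alpha>. closed_segment (-\<alpha>) \<alpha>)) \<alpha> =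
        closed_segment (- ((1/2) *\<^sub>R \<alpha>)) ((1/2) *\<^sub>R \<alpha>)"
      unfolding comp_apply scaleR_minus_right by (rule sym)
  qed
  finally show ?thesis by (simp add: coxeter_zonotope_def)
qed

lemma polytope_Z: "polytope Z"
  by (simp add: coxeter_zonotope_eq polytope_zonotope finite_roots)

text \<open>The terms of \<alpha> and -\<alpha> agree, so this is the sum of all roots positive on
  \<open>c\<close>: twice the Weyl vector for regular \<open>c\<close>, and otherwise the centre of
  the face on which \<open>c\<close> is maximal.\<close>

definition top_vertex :: "'a \<Rightarrow> 'a" where
  "top_vertex c = (\<Sum>\<alpha>\<in>\<Phi>. (sgn (c \<bullet> \<alpha>) / 2) *\<^sub>R \<alpha>)"

lemma maximizes_Z_iff:
  fixes t :: "'a \<Rightarrow> real"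
  assumes "\<And>\<alpha>. \<alpha> \<in> \<Phi> \<Longrightarrow> \<bar>t \<alpha>\<bar> \<le> 1"
  shows "maximizes Z c (\<Sum>\<alpha>\<in>\<Phi>. (t \<alpha> / 2) *\<^sub>R \<alpha>) \<longleftrightarrow> (\<forall>\<alpha>\<in>\<Phi>. t \<alpha> * (c \<bullet> \<alpha>) = \<bar>c \<bullet> \<alpha>\<bar>)"
  using maximizes_zonotope_iff[where w = "\<lambda>\<alpha>. (1/2) *\<^sub>R \<alpha>" and c = c and t = t, OF finite_roots assms]
  by (simp add: coxeter_zonotope_eq)

lemma Z_eq: "Z = {\<Sum>\<alpha>\<in>\<Phi>. (t \<alpha> / 2) *\<^sub>R \<alpha> | t. \<forall>\<alpha>\<in>\<Phi>. \<bar>t \<alpha>\<bar> \<le> 1}"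
  unfolding coxeter_zonotope_eq zonotope_eq[OF finite_roots] by simp

lemma maximizes_top_vertex_iff:
  "maximizes Z c (top_vertex f) \<longleftrightarrow> (\<forall>\<alpha>\<in>\<Phi>. sgn (f \<bullet> \<alpha>) * (c \<bullet> \<alpha>) = \<bar>c \<bullet> \<alpha>\<bar>)"
  unfolding top_vertex_def by (rule maximizes_Z_iff) (simp add: abs_sgn_eq)

lemma maximizes_top_vertex: "maximizes Z c (top_vertex c)"
  by (simp add: maximizes_top_vertex_iff sgn_mult_self_abs)

definition regular :: "'a \<Rightarrow> bool" where
  "regular f \<longleftrightarrow> (\<forall>\<alpha>\<in>\<Phi>. f \<bullet> \<alpha> \<noteq> 0)"

lemma maximizes_Z_unique:
  assumes "\<And>\<alpha>. \<alpha> \<in> \<Phi> \<Longrightarrow> c \<bullet> \<alpha> \<noteq> 0" "maximizes Z c x"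
  shows "x = top_vertex c"
proof -
  obtain t where t: "x = (\<Sum>\<alpha>\<in>\<Phi>. (t \<alpha> / 2) *\<^sub>R \<alpha>)" "\<And>\<alpha>. \<alpha> \<in> \<Phi> \<Longrightarrow> \<bar>t \<alpha>\<bar> \<le> 1"
    using assms(2) by (auto simp: maximizes_def Z_eq)
  with assms(2) have "\<forall>\<alpha>\<in>\<Phi>. t \<alpha> * (c \<bullet> \<alpha>) = \<bar>c \<bullet> \<alpha>\<bar>" by (simp add: maximizes_Z_iff)
  then have "t \<alpha> = sgn (c \<bullet> \<alpha>)" if "\<alpha> \<in> \<Phi>" for \<alpha>
    using that assms(1)[OF that] mult_eq_abs_imp_sgn[of "t \<alpha>" "c \<bullet> \<alpha>"] by auto
  then show ?thesis unfolding t(1) top_vertex_def by (intro sum.cong) auto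
qed

lemma vertices_Z: "vertices Z = top_vertex ` {f. regular f}"
proof (intro equalityI subsetI)
  fix v assume "v \<in> vertices Z"
  then have v: "v extreme_point_of Z" by (simp add: vertices_def)
  obtain c where c: "\<And>f. f \<in> \<Phi> \<Longrightarrow> c \<bullet> f \<noteq> 0" "\<And>x. x \<in> Z \<Longrightarrow> x \<noteq> v \<Longrightarrow> c \<bullet> x < c \<bullet> v"
    using extreme_point_generic_maximizer[OF polytope_Z v finite_roots] root_nonzero by metis
  have "v \<in> Z" using v by (auto simp: extreme_point_of_def)
  then have "maximizes Z c v" unfolding maximizes_def using c(2) by (metis less_eq_real_def)
  from maximizes_Z_unique[OF c(1) this] c(1) show "v \<in> top_vertex ` {f. regular f}"
    by (auto simp: regular_def)
next
  fix v assume "v \<in> top_vertex ` {f. regular f}"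
  then obtain f where f: "regular f" "v = top_vertex f" by auto
  have "Z \<inter> {x. f \<bullet> x = f \<bullet> v} = {v}"
  proof (intro equalityI subsetI)
    fix x assume "x \<in> Z \<inter> {x. f \<bullet> x = f \<bullet> v}"
    then have "maximizes Z f x"
      using maximizes_top_vertex[of f] by (auto simp: f(2) maximizes_def)
    with maximizes_Z_unique[of f x] f show "x \<in> {v}" by (auto simp: regular_def)
  next
    fix x assume "x \<in> {v}"
    then show "x \<in> Z \<inter> {x. f \<bullet> x = f \<bullet> v}"
      using maximizes_top_vertex[of f] by (auto simp: f(2) maximizes_def)
  qed
  moreover have "(Z \<inter> {x. f \<bullet> x = f \<bullet> v}) face_of Z"
    by (rule face_of_Int_supporting_hyperplane_le)
      (use polytope_Z maximizes_top_vertex[of f] in \<open>auto simp: polytope_imp_convex maximizes_def f(2)\<close>)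
  ultimately show "v \<in> vertices Z" by (simp add: vertices_def face_of_singleton)
qed

lemma finite_vertices: "finite (vertices Z)"
  unfolding vertices_def by (rule polytope_eq_hull_extreme(1)[OF polytope_Z])

lemma top_vertex_cong: "(\<And>\<alpha>. \<alpha> \<in> \<Phi> \<Longrightarrow> sgn (f \<bullet> \<alpha>) = sgn (g \<bullet> \<alpha>)) \<Longrightarrow> top_vertex f = top_vertex g"
  by (simp add: top_vertex_def)

lemma top_vertex_across:
  assumes "\<delta> \<in> \<Phi>" "a \<bullet> \<delta> = 0" "\<And>\<alpha>. \<alpha> \<in> \<Phi> - {\<delta>, -\<delta>} \<Longrightarrow> sgn (a \<bullet> \<alpha>) = sgn (f \<bullet> \<alpha>)"
  shows "top_vertex f = top_vertex a + sgn (f \<bullet> \<delta>) *\<^sub>R \<delta>"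
proof -
  have "(\<Sum>\<alpha>\<in>\<Phi> - {\<delta>, -\<delta>}. (sgn (f \<bullet> \<alpha>) / 2) *\<^sub>R \<alpha>) = (\<Sum>\<alpha>\<in>\<Phi> - {\<delta>, -\<delta>}. (sgn (a \<bullet> \<alpha>) / 2) *\<^sub>R \<alpha>)"
    by (intro sum.cong refl) (simp only: assms(3))
  then show ?thesis
    unfolding top_vertex_def sum_roots_split[OF assms(1)]
    by (simp add: assms(2) sgn_minus scaleR_add_left[symmetric])
qed

text \<open>The coefficients of \<gamma> and -\<gamma> do not influence the value of
  \<open>a\<close>. Choosing \<open>r\<close> and \<open>- r\<close> for them shifts the centre of
  the face by \<open>r *\<^sub>R \<gamma>\<close>.\<close>

lemma maximizes_Z_orthogonal_root:
  assumes "\<gamma> \<in> \<Phi>" "a \<bullet> \<gamma> = 0" "\<bar>r\<bar> \<le> 1"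
  shows "maximizes Z a (top_vertex a + r *\<^sub>R \<gamma>)"
proof -
  let ?t = "\<lambda>\<alpha>. if \<alpha> = \<gamma> then r else if \<alpha> = - \<gamma> then - r else sgn (a \<bullet> \<alpha>)"
  have "\<gamma> \<noteq> - \<gamma>" using root_neq_uminus[OF assms(1)] .
  then have "(\<Sum>\<alpha>\<in>\<Phi>. (?t \<alpha> / 2) *\<^sub>R \<alpha>) = top_vertex a + r *\<^sub>R \<gamma>"
    unfolding top_vertex_def sum_roots_split[OF assms(1)]
    using assms(2) by (simp add: scaleR_add_left[symmetric])
  moreover have "maximizes Z a (\<Sum>\<alpha>\<in>\<Phi>. (?t \<alpha> / 2) *\<^sub>R \<alpha>)"
    using assms by (subst maximizes_Z_iff)
      (auto simp: abs_sgn_eq sgn_mult_self_abs)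
  ultimately show ?thesis by simp
qed

text \<open>Such an \<open>a\<close> lies in the relative interior of a common facet of two
  chambers, which is the normal cone of an edge.\<close>

definition edge_normal :: "'a \<Rightarrow> 'a \<Rightarrow> bool" where
  "edge_normal a \<gamma> \<longleftrightarrow> \<gamma> \<in> \<Phi> \<and> a \<bullet> \<gamma> = 0 \<and> (\<forall>\<alpha>\<in>\<Phi> - {\<gamma>, -\<gamma>}. a \<bullet> \<alpha> \<noteq> 0)"

lemma edge_normal_face:
  assumes "edge_normal a \<gamma>"
  shows "{x. maximizes Z a x} = closed_segment (top_vertex a + \<gamma>) (top_vertex a - \<gamma>)"
proof -
  have \<gamma>: "\<gamma> \<in> \<Phi>" "a \<bullet> \<gamma> = 0" using assms by (auto simp: edge_normal_def)
  have "\<exists>r. \<bar>r\<bar> \<le> 1 \<and> x = top_vertex a + r *\<^sub>R \<gamma>" if m: "maximizes Z a x" for x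
  proof -
    obtain t where t: "x = (\<Sum>\<alpha>\<in>\<Phi>. (t \<alpha> / 2) *\<^sub>R \<alpha>)" "\<And>\<alpha>. \<alpha> \<in> \<Phi> \<Longrightarrow> \<bar>t \<alpha>\<bar> \<le> 1"
      using m by (auto simp: maximizes_def Z_eq)
    with m have *: "\<forall>\<alpha>\<in>\<Phi>. t \<alpha> * (a \<bullet> \<alpha>) = \<bar>a \<bullet> \<alpha>\<bar>" by (simp add: maximizes_Z_iff)
    have "t \<alpha> = sgn (a \<bullet> \<alpha>)" if "\<alpha> \<in> \<Phi> - {\<gamma>, -\<gamma>}" for \<alpha>
      using * that assms mult_eq_abs_imp_sgn by (metis DiffD1 edge_normal_def)
    then have "(\<Sum>\<alpha>\<in>\<Phi> - {\<gamma>, -\<gamma>}. (t \<alpha> / 2) *\<^sub>R \<alpha>) = (\<Sum>\<alpha>\<in>\<Phi> - {\<gamma>, -\<gamma>}. (sgn (a \<bullet> \<alpha>) / 2) *\<^sub>R \<alpha>)"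
      by (intro sum.cong) auto
    then have "x = top_vertex a + ((t \<gamma> - t (- \<gamma>)) / 2) *\<^sub>R \<gamma>"
      unfolding t(1) top_vertex_def sum_roots_split[OF \<gamma>(1)]
      using \<gamma>(2) by (simp add: diff_divide_distrib scaleR_diff_left)
    moreover have "\<bar>(t \<gamma> - t (- \<gamma>)) / 2\<bar> \<le> 1"
      using t(2)[OF \<gamma>(1)] t(2)[OF uminus_root[OF \<gamma>(1)]] by (auto simp: abs_le_iff)
    ultimately show ?thesis by blast
  qed
  then have "{x. maximizes Z a x} = (+) (top_vertex a) ` closed_segment (- \<gamma>) \<gamma>"
    unfolding closed_segment_uminus using maximizes_Z_orthogonal_root[OF \<gamma>] by fastforce
  also have "\<dots> = closed_segment (top_vertex a + - \<gamma>) (top_vertex a + \<gamma>)"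
    by (rule closed_segment_translation[symmetric])
  finally show ?thesis by (simp add: closed_segment_commute)
qed

text \<open>Let \<open>a\<close> expose an edge. Moving from the centre of the edge along a root
  orthogonal to \<open>a\<close> stays in the face, so every such root is parallel to the edge. At
  least one exists, since otherwise the face would be a point.\<close>

lemma adjacent_Z_iff:
  "adjacent Z u v \<longleftrightarrow> (\<exists>a \<gamma>. edge_normal a \<gamma> \<and> u = top_vertex a + \<gamma> \<and> v = top_vertex a - \<gamma>)"
proof
  assume "adjacent Z u v"
  then have face: "closed_segment u v face_of Z" and dim: "aff_dim (closed_segment u v) = 1"
    by (auto simp: adjacent_def edge_of_def)
  from dim have "u \<noteq> v" by auto
  from face have "closed_segment u v exposed_face_of Z"
    by (simp add: exposed_face_of_polyhedron polytope_imp_polyhedron polytope_Z)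
  then obtain a b where ab: "Z \<subseteq> {x. a \<bullet> x \<le> b}" "closed_segment u v = Z \<inter> {x. a \<bullet> x = b}"
    by (auto simp: exposed_face_of_def)
  have "u \<in> Z" "a \<bullet> u = b" using ab(2) by auto
  then have seg: "closed_segment u v = {x. maximizes Z a x}"
    using ab by (force simp: maximizes_def)
  have on_line: "\<exists>k. \<gamma> = k *\<^sub>R (v - u)" if \<gamma>: "\<gamma> \<in> \<Phi>" "a \<bullet> \<gamma> = 0" for \<gamma>
  proof -
    have "top_vertex a \<in> closed_segment u v" "top_vertex a + 1 *\<^sub>R \<gamma> \<in> closed_segment u v"
      unfolding seg using maximizes_top_vertex maximizes_Z_orthogonal_root[OF \<gamma>, of 1] by auto
    then obtain p q where "top_vertex a = (1 - p) *\<^sub>R u + p *\<^sub>R v" "top_vertex a + \<gamma> = (1 - q) *\<^sub>R u + q *\<^sub>R v"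
      by (auto simp: in_segment)
    then have "\<gamma> = ((1 - q) *\<^sub>R u + q *\<^sub>R v) - ((1 - p) *\<^sub>R u + p *\<^sub>R v)" by (metis add_diff_cancel_left')
    also have "\<dots> = (q - p) *\<^sub>R (v - u)" by (simp add: algebra_simps)
    finally show ?thesis by blast
  qed
  have "\<exists>\<gamma>\<in>\<Phi>. a \<bullet> \<gamma> = 0"
  proof (rule ccontr)
    assume "\<not> ?thesis"
    then have "x = top_vertex a" if "maximizes Z a x" for x using maximizes_Z_unique that by auto
    then have "u = v" using seg by (metis ends_in_segment(1,2) mem_Collect_eq)
    with \<open>u \<noteq> v\<close> show False ..
  qed
  then obtain \<gamma> where \<gamma>: "\<gamma> \<in> \<Phi>" "a \<bullet> \<gamma> = 0" by blast
  have "a \<bullet> \<alpha> \<noteq> 0" if "\<alpha> \<in> \<Phi> - {\<gamma>, - \<gamma>}" for \<alpha>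
  proof
    assume "a \<bullet> \<alpha> = 0"
    with that obtain k where k: "\<alpha> = k *\<^sub>R (v - u)" using on_line by blast
    obtain l where l: "\<gamma> = l *\<^sub>R (v - u)" using on_line \<gamma> by blast
    with root_nonzero[OF \<gamma>(1)] have "l \<noteq> 0" by auto
    with k l have "\<alpha> = (k / l) *\<^sub>R \<gamma>" by simp
    with parallel_root[OF \<gamma>(1), of "k / l"] that show False by auto
  qed
  with \<gamma> have en: "edge_normal a \<gamma>" by (simp add: edge_normal_def)
  \<comment> \<open>The endpoints are only known as an unordered pair, so matching them with
    \<open>u\<close> and \<open>v\<close> may require reversing \<gamma>.\<close>
  then have en': "edge_normal a (- \<gamma>)" by (auto simp: edge_normal_def uminus_root)
  from edge_normal_face[OF en] seg have "{u, v} = {top_vertex a + \<gamma>, top_vertex a - \<gamma>}" by simp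
  then consider "u = top_vertex a + \<gamma>" "v = top_vertex a - \<gamma>" | "u = top_vertex a - \<gamma>" "v = top_vertex a + \<gamma>"
    by (auto simp: doubleton_eq_iff)
  then show "\<exists>a \<gamma>. edge_normal a \<gamma> \<and> u = top_vertex a + \<gamma> \<and> v = top_vertex a - \<gamma>"
  proof cases
    case 1
    with en show ?thesis by blast
  next
    case 2
    with en' show ?thesis by (intro exI[of _ a] exI[of _ "- \<gamma>"]) auto
  qed
next
  assume "\<exists>a \<gamma>. edge_normal a \<gamma> \<and> u = top_vertex a + \<gamma> \<and> v = top_vertex a - \<gamma>"
  then obtain a \<gamma> where en: "edge_normal a \<gamma>" and uv: "u = top_vertex a + \<gamma>" "v = top_vertex a - \<gamma>"
    by blast
  have "\<gamma> \<noteq> 0" using en root_nonzero by (auto simp: edge_normal_def)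
  then have "u - v \<noteq> 0" unfolding uv using scaleR_2[of \<gamma>] by auto
  then have "u \<noteq> v" by simp
  have "closed_segment u v = Z \<inter> {x. a \<bullet> x = a \<bullet> top_vertex a}"
    unfolding uv edge_normal_face[OF en, symmetric]
    using maximizes_top_vertex[of a] by (force simp: maximizes_def)
  moreover have "(Z \<inter> {x. a \<bullet> x = a \<bullet> top_vertex a}) face_of Z"
    by (rule face_of_Int_supporting_hyperplane_le)
      (use polytope_Z maximizes_top_vertex[of a] in \<open>auto simp: polytope_imp_convex maximizes_def\<close>)
  moreover have "aff_dim (closed_segment u v) = 1"
    using \<open>u \<noteq> v\<close> by (simp add: segment_convex_hull aff_dim_convex_hull)
  ultimately show "adjacent Z u v" by (simp add: adjacent_def edge_of_def)
qed

text \<open>The witness \<open>a\<close> lies in the relative interior of the facet that \<delta>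
  cuts out of the chamber of \<open>f\<close>. Being negative on \<open>f\<close>, the normal
  \<delta> points out of the chamber, so adding a positive multiple of it to the vertex crosses the
  facet.\<close>

definition wall :: "'a \<Rightarrow> 'a \<Rightarrow> bool" where
  "wall f \<delta> \<longleftrightarrow> \<delta> \<in> \<Phi> \<and> f \<bullet> \<delta> < 0 \<and>
     (\<exists>a. a \<bullet> \<delta> = 0 \<and> (\<forall>\<alpha>\<in>\<Phi> - {\<delta>, -\<delta>}. sgn (a \<bullet> \<alpha>) = sgn (f \<bullet> \<alpha>)))"

text \<open>Since \<open>top_vertex f\<close> maximizes \<open>a\<close>, the signs of
  \<open>f\<close> and \<open>a\<close> agree wherever \<open>a\<close> is nonzero. Which end of the
  edge the vertex is decides the sign of \<open>f \<bullet> \<gamma>\<close>.\<close>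

lemma adjacent_top_vertex_iff:
  assumes "regular f"
  shows "adjacent Z u (top_vertex f) \<longleftrightarrow> (\<exists>\<delta>. wall f \<delta> \<and> u = top_vertex f + 2 *\<^sub>R \<delta>)"
proof
  assume "adjacent Z u (top_vertex f)"
  then obtain a \<gamma> where en: "edge_normal a \<gamma>" and u: "u = top_vertex a + \<gamma>"
    and f: "top_vertex f = top_vertex a - \<gamma>" by (auto simp: adjacent_Z_iff)
  have \<gamma>: "\<gamma> \<in> \<Phi>" "a \<bullet> \<gamma> = 0" using en by (auto simp: edge_normal_def)
  have "maximizes Z a (top_vertex f)"
    using maximizes_Z_orthogonal_root[OF \<gamma>, of "-1"] by (simp add: f)
  then have *: "sgn (f \<bullet> \<alpha>) * (a \<bullet> \<alpha>) = \<bar>a \<bullet> \<alpha>\<bar>" if "\<alpha> \<in> \<Phi>" for \<alpha>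
    using that by (simp add: maximizes_top_vertex_iff)
  have sg: "sgn (a \<bullet> \<alpha>) = sgn (f \<bullet> \<alpha>)" if "\<alpha> \<in> \<Phi> - {\<gamma>, - \<gamma>}" for \<alpha>
    using mult_eq_abs_imp_sgn[OF *, of \<alpha>] that en by (auto simp: edge_normal_def)
  have "(sgn (f \<bullet> \<gamma>) + 1) *\<^sub>R \<gamma> = 0"
    using top_vertex_across[of \<gamma> a f, OF \<gamma> sg] f
    by (metis add_eq_0_iff add_left_cancel diff_conv_add_uminus scaleR_add_left scaleR_one add.commute)
  then have "f \<bullet> \<gamma> < 0" using root_nonzero[OF \<gamma>(1)] by (auto simp: sgn_if split: if_splits)
  with sg \<gamma> have "wall f \<gamma>" by (auto simp: wall_def)
  moreover have "u = top_vertex f + 2 *\<^sub>R \<gamma>" unfolding u f by (simp add: scaleR_2)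
  ultimately show "\<exists>\<delta>. wall f \<delta> \<and> u = top_vertex f + 2 *\<^sub>R \<delta>" by blast
next
  assume "\<exists>\<delta>. wall f \<delta> \<and> u = top_vertex f + 2 *\<^sub>R \<delta>"
  then obtain \<delta> a where \<delta>: "\<delta> \<in> \<Phi>" "f \<bullet> \<delta> < 0" "u = top_vertex f + 2 *\<^sub>R \<delta>" "a \<bullet> \<delta> = 0"
    and sg: "\<And>\<alpha>. \<alpha> \<in> \<Phi> - {\<delta>, -\<delta>} \<Longrightarrow> sgn (a \<bullet> \<alpha>) = sgn (f \<bullet> \<alpha>)"
    by (auto simp: wall_def)
  have "edge_normal a \<delta>"
    unfolding edge_normal_def using \<delta> sg assms by (metis DiffD1 regular_def sgn_0_0)
  moreover have "top_vertex f = top_vertex a - \<delta>"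
    using top_vertex_across[of \<delta> a f, OF \<delta>(1,4) sg] \<delta>(2) by simp
  moreover from this have "u = top_vertex a + \<delta>" using \<delta>(3) by (simp add: scaleR_2)
  ultimately show "adjacent Z u (top_vertex f)" unfolding adjacent_Z_iff by blast
qed

end

section \<open>Simple roots\<close>

context crystallographic_roots
begin

text \<open>At the point \<open>a\<close> of the facet both summands would be negative although
  their sum vanishes.\<close>

lemma wall_indecomposable:
  assumes "wall f \<delta>" "\<beta> \<in> \<Phi>" "\<gamma> \<in> \<Phi>" "f \<bullet> \<beta> < 0" "f \<bullet> \<gamma> < 0"
  shows "\<delta> \<noteq> \<beta> + \<gamma>"
proof
  assume \<delta>: "\<delta> = \<beta> + \<gamma>"
  obtain a where a: "f \<bullet> \<delta> < 0" "a \<bullet> \<delta> = 0" "\<And>\<alpha>. \<alpha> \<in> \<Phi> - {\<delta>, -\<delta>} \<Longrightarrow> sgn (a \<bullet> \<alpha>) = sgn (f \<bullet> \<alpha>)"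
    using assms(1) by (auto simp: wall_def)
  have "\<beta> \<noteq> \<delta>" "\<gamma> \<noteq> \<delta>" using \<delta> assms(2,3) root_nonzero by auto
  moreover have "\<beta> \<noteq> - \<delta>" "\<gamma> \<noteq> - \<delta>" using a(1) assms(4,5) by auto
  ultimately have "sgn (a \<bullet> \<beta>) = -1" "sgn (a \<bullet> \<gamma>) = -1" using a(3) assms by auto
  then have "a \<bullet> \<beta> < 0" "a \<bullet> \<gamma> < 0" by (simp_all add: sgn_1_neg)
  with a(2) show False by (simp add: \<delta> inner_add_right)
qed

text \<open>An acute pair has a root as its difference. Whatever sign \<open>f\<close> gives this
  root, one of the two walls becomes a sum of two roots negative on \<open>f\<close>.\<close>

lemma wall_inner_nonpos:
  assumes "regular f" "wall f \<delta>" "wall f \<gamma>" "\<delta> \<noteq> \<gamma>"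
  shows "\<delta> \<bullet> \<gamma> \<le> 0"
proof (rule ccontr)
  assume "\<not> \<delta> \<bullet> \<gamma> \<le> 0"
  moreover have in\<Phi>: "\<delta> \<in> \<Phi>" "\<gamma> \<in> \<Phi>" "f \<bullet> \<delta> < 0" "f \<bullet> \<gamma> < 0" using assms by (auto simp: wall_def)
  ultimately have root: "\<delta> - \<gamma> \<in> \<Phi>" using diff_root assms(4) by auto
  with uminus_root[OF this] have root': "\<gamma> - \<delta> \<in> \<Phi>" by simp
  have "f \<bullet> (\<delta> - \<gamma>) \<noteq> 0" using root assms(1) by (auto simp: regular_def)
  then consider "f \<bullet> (\<delta> - \<gamma>) < 0" | "f \<bullet> (\<gamma> - \<delta>) < 0" by (fastforce simp: inner_diff_right)
  then show False
  proof cases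
    case 1
    with wall_indecomposable[OF assms(2) root in\<Phi>(2)] in\<Phi> show False by simp
  next
    case 2
    with wall_indecomposable[OF assms(3) root' in\<Phi>(1)] in\<Phi> show False by simp
  qed
qed

text \<open>The wall is the first one crossed on the way from \<open>f\<close> to \<open>c\<close>, after moving \<open>f\<close> slightly
  so that distinct walls are crossed at distinct times.\<close>

lemma improving_wall:
  assumes "regular f" "regular c" "top_vertex f \<noteq> top_vertex c"
  obtains \<delta> where "wall f \<delta>" "c \<bullet> \<delta> > 0"
proof -
  \<comment> \<open>The vector for a pair (\<beta>, \<delta>) is orthogonal to \<open>g\<close>
    exactly when both hyperplanes are met at the same time on the way to \<open>c\<close>.\<close>
  let ?K = "\<Phi> \<union> (\<lambda>(\<beta>, \<delta>). (c \<bullet> \<beta>) *\<^sub>R \<delta> - (c \<bullet> \<delta>) *\<^sub>R \<beta>) ` (\<Phi> \<times> \<Phi>)"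
  have "finite ?K" using finite_roots by auto
  from exists_generic_point[OF subspace_UNIV UNIV_I this, of f]
  obtain g where g: "\<And>k. k \<in> ?K \<Longrightarrow> f \<bullet> k \<noteq> 0 \<Longrightarrow> sgn (g \<bullet> k) = sgn (f \<bullet> k)"
    "\<And>k x. k \<in> ?K \<Longrightarrow> x \<in> UNIV \<Longrightarrow> x \<bullet> k \<noteq> 0 \<Longrightarrow> g \<bullet> k \<noteq> 0" by blast
  have gf: "sgn (g \<bullet> \<alpha>) = sgn (f \<bullet> \<alpha>)" if "\<alpha> \<in> \<Phi>" for \<alpha>
    using g(1)[of \<alpha>] that assms(1) by (auto simp: regular_def)
  then have g0: "g \<bullet> \<alpha> \<noteq> 0" if "\<alpha> \<in> \<Phi>" for \<alpha>
    using that assms(1) by (metis regular_def sgn_0_0)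
  define M where "M = {\<delta> \<in> \<Phi>. g \<bullet> \<delta> < 0 \<and> c \<bullet> \<delta> > 0}"
  have "finite M" using finite_roots by (simp add: M_def)
  have "M \<noteq> {}"
  proof -
    obtain \<alpha> where \<alpha>: "\<alpha> \<in> \<Phi>" "sgn (f \<bullet> \<alpha>) \<noteq> sgn (c \<bullet> \<alpha>)"
      using top_vertex_cong[of f c] assms(3) by blast
    with gf have "sgn (g \<bullet> \<alpha>) \<noteq> sgn (c \<bullet> \<alpha>)" by simp
    with g0[OF \<alpha>(1)] assms(2) \<alpha>(1) have "(g \<bullet> \<alpha> < 0 \<and> c \<bullet> \<alpha> > 0) \<or> (g \<bullet> \<alpha> > 0 \<and> c \<bullet> \<alpha> < 0)"
      by (auto simp: regular_def sgn_if split: if_splits)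
    then have "\<alpha> \<in> M \<or> - \<alpha> \<in> M" using \<alpha>(1) uminus_root by (auto simp: M_def)
    then show ?thesis by auto
  qed
  \<comment> \<open>The ray \<open>g + s *\<^sub>R c\<close> meets the hyperplane of \<beta> at
    \<open>s = - (g \<bullet> \<beta>) / (c \<bullet> \<beta>)\<close>, so the earliest crossing has
    the largest reciprocal.\<close>
  then obtain \<delta> where \<delta>: "\<delta> \<in> M"
    "\<And>\<beta>. \<beta> \<in> M \<Longrightarrow> (c \<bullet> \<beta>) / - (g \<bullet> \<beta>) \<le> (c \<bullet> \<delta>) / - (g \<bullet> \<delta>)"
    using finite_maximizer[OF \<open>finite M\<close>, of "\<lambda>\<beta>. (c \<bullet> \<beta>) / - (g \<bullet> \<beta>)"] by metis
  have d: "\<delta> \<in> \<Phi>" "g \<bullet> \<delta> < 0" "c \<bullet> \<delta> > 0" using \<delta>(1) by (auto simp: M_def)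
  \<comment> \<open>This is the crossing point up to a positive factor; both coefficients of the
    combination are positive.\<close>
  define a where "a = (c \<bullet> \<delta>) *\<^sub>R g - (g \<bullet> \<delta>) *\<^sub>R c"
  have a: "a \<bullet> \<beta> = (c \<bullet> \<delta>) * (g \<bullet> \<beta>) - (g \<bullet> \<delta>) * (c \<bullet> \<beta>)" for \<beta>
    by (simp add: a_def inner_diff_left)
  have neg: "a \<bullet> \<beta> < 0" if \<beta>: "\<beta> \<in> \<Phi>" "\<beta> \<noteq> \<delta>" "\<beta> \<noteq> - \<delta>" "g \<bullet> \<beta> < 0" for \<beta>
  proof (cases "c \<bullet> \<beta> > 0")
    case False
    then have "(g \<bullet> \<delta>) * (c \<bullet> \<beta>) \<ge> 0" using d by (simp add: mult_nonpos_nonpos)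
    moreover have "(c \<bullet> \<delta>) * (g \<bullet> \<beta>) < 0" using d \<beta> by (simp add: mult_pos_neg)
    ultimately show ?thesis by (simp add: a)
  next
    case True
    then have "\<beta> \<in> M" using \<beta> by (simp add: M_def)
    from \<delta>(2)[OF this] have le: "a \<bullet> \<beta> \<le> 0" using d \<beta> by (simp add: a field_simps)
    have "(c \<bullet> \<beta>) *\<^sub>R \<delta> - (c \<bullet> \<delta>) *\<^sub>R \<beta> \<noteq> 0"
    proof
      assume "(c \<bullet> \<beta>) *\<^sub>R \<delta> - (c \<bullet> \<delta>) *\<^sub>R \<beta> = 0"
      then have "(1 / (c \<bullet> \<delta>)) *\<^sub>R ((c \<bullet> \<delta>) *\<^sub>R \<beta>) = (1 / (c \<bullet> \<delta>)) *\<^sub>R ((c \<bullet> \<beta>) *\<^sub>R \<delta>)" by simp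
      then have "\<beta> = ((c \<bullet> \<beta>) / (c \<bullet> \<delta>)) *\<^sub>R \<delta>" using d(3) by simp
      with parallel_root[OF d(1), of "(c \<bullet> \<beta>) / (c \<bullet> \<delta>)"] \<beta> show False by auto
    qed
    moreover have "(c \<bullet> \<beta>) *\<^sub>R \<delta> - (c \<bullet> \<delta>) *\<^sub>R \<beta> \<in> ?K"
      by (intro UnI2 image_eqI[of _ _ "(\<beta>, \<delta>)"]) (use \<beta>(1) d(1) in auto)
    ultimately have "g \<bullet> ((c \<bullet> \<beta>) *\<^sub>R \<delta> - (c \<bullet> \<delta>) *\<^sub>R \<beta>) \<noteq> 0"
      using g(2)[OF _ UNIV_I] inner_eq_zero_iff by blast
    then have "a \<bullet> \<beta> \<noteq> 0" by (simp add: a inner_diff_right algebra_simps)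
    with le show ?thesis by simp
  qed
  have "sgn (a \<bullet> \<alpha>) = sgn (f \<bullet> \<alpha>)" if \<alpha>: "\<alpha> \<in> \<Phi> - {\<delta>, - \<delta>}" for \<alpha>
  proof (cases "g \<bullet> \<alpha> < 0")
    case True
    with neg[of \<alpha>] \<alpha> gf[of \<alpha>] show ?thesis by auto
  next
    case False
    have "- \<alpha> \<in> \<Phi>" "- \<alpha> \<noteq> \<delta>" "- \<alpha> \<noteq> - \<delta>" using \<alpha> uminus_root by auto
    moreover have "g \<bullet> \<alpha> > 0" using False g0[of \<alpha>] \<alpha> by auto
    ultimately show ?thesis using neg[of "- \<alpha>"] gf[of \<alpha>] \<alpha> by auto
  qed
  moreover have "a \<bullet> \<delta> = 0" by (simp add: a)
  moreover have "f \<bullet> \<delta> < 0" using gf[OF d(1)] d(2) by (simp add: sgn_if split: if_splits)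
  ultimately have "wall f \<delta>" using d(1) by (auto simp: wall_def)
  with d(3) that show thesis by blast
qed

text \<open>The Cartan integers of \<open>\<alpha>\<close>, \<open>\<beta>\<close> and \<open>\<delta> = m \<alpha> - n \<beta>\<close> determine \<open>m\<close> and \<open>n\<close>; apart from
  \<open>m = n\<close> only configurations inside \<open>G\<^sub>2\<close> and \<open>BC\<^sub>2\<close> remain.\<close>

lemma cartan_integer_cases:
  fixes p q x x' y y' :: int
  assumes "p \<ge> 0" "q \<ge> 0" "p * q < 4" "p = 0 \<longleftrightarrow> q = 0"
    and "x > 0" "x' > 0" "x * x' < 4" "y > 0" "y' > 0" "y * y' < 4"
    and "2 * x - p * y > 0" "2 * y - q * x > 0"
    and "2 * (4 - p * q) = x' * (2 * x - p * y) + y' * (2 * y - q * x)"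
    and "p * x' * y = q * y' * x"
  shows "2 * x - p * y = 2 * y - q * x \<or> (p = 0 \<and> q = 0 \<and>
    (x = 1 \<and> y = 3 \<and> y' = 1 \<or> x = 3 \<and> y = 1 \<and> x' = 1 \<or> x = 1 \<and> y = 2 \<and> x' = 2 \<or> x = 2 \<and> y = 1 \<and> y' = 2))"
proof -
  have bound: "s \<in> {1, 2, 3} \<and> t \<in> {1, 2, 3}" if "s > 0" "t > 0" "s * t < 4" for s t :: int
  proof -
    have "s * 1 \<le> s * t" "1 * t \<le> s * t" using that by (intro mult_left_mono mult_right_mono; simp)+
    then have "s < 4" "t < 4" using that(3) by linarith+
    then have "s = 1 \<or> s = 2 \<or> s = 3" "t = 1 \<or> t = 2 \<or> t = 3" using that(1,2) by arith+
    then show ?thesis by auto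
  qed
  have "p = 0 \<and> q = 0 \<or> p \<in> {1, 2, 3} \<and> q \<in> {1, 2, 3}"
    using bound[of p q] assms(1-4) by fastforce
  moreover have "x \<in> {1, 2, 3} \<and> x' \<in> {1, 2, 3}" "y \<in> {1, 2, 3} \<and> y' \<in> {1, 2, 3}"
    using bound assms by auto
  ultimately show ?thesis using assms(3-) by (elim insertE conjE disjE emptyE) simp_all
qed

text \<open>A root strictly between \<alpha> and -\<beta> keeps \<alpha> and \<beta> from being
  simple in their plane. Integrality leaves finitely many shapes, and each either makes \<alpha> -
  \<beta> parallel to a root or contains a root together with its double.\<close>

lemma opposite_sign_root:
  assumes "\<alpha> \<in> \<Phi>" "\<beta> \<in> \<Phi>" "\<beta> \<noteq> \<alpha>" "\<beta> \<noteq> - \<alpha>" "\<alpha> \<bullet> \<beta> \<le> 0"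
    and mn: "m > 0" "n > 0" and \<delta>: "m *\<^sub>R \<alpha> - n *\<^sub>R \<beta> \<in> \<Phi>"
  shows "\<exists>s. s *\<^sub>R (\<alpha> - \<beta>) \<in> \<Phi>"
proof -
  define \<delta> where "\<delta> = m *\<^sub>R \<alpha> - n *\<^sub>R \<beta>"
  have \<delta>\<Phi>: "\<delta> \<in> \<Phi>" using \<delta> by (simp add: \<delta>_def)
  have par: "\<beta> \<noteq> s *\<^sub>R \<alpha>" "\<alpha> \<noteq> s *\<^sub>R \<beta>" for s
    using parallel_root[OF assms(1), of s] parallel_root[OF assms(2), of s] assms(1-4) by auto
  have ne\<alpha>: "\<delta> \<noteq> s *\<^sub>R \<alpha>" for s
  proof
    assume "\<delta> = s *\<^sub>R \<alpha>"
    then have "n *\<^sub>R \<beta> = (m - s) *\<^sub>R \<alpha>" by (simp add: \<delta>_def algebra_simps)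
    then have "(1 / n) *\<^sub>R (n *\<^sub>R \<beta>) = (1 / n) *\<^sub>R ((m - s) *\<^sub>R \<alpha>)" by (rule arg_cong)
    with mn par(1)[of "(m - s) / n"] show False by simp
  qed
  have ne\<beta>: "\<delta> \<noteq> s *\<^sub>R \<beta>" for s
  proof
    assume "\<delta> = s *\<^sub>R \<beta>"
    then have "m *\<^sub>R \<alpha> = (s + n) *\<^sub>R \<beta>" by (simp add: \<delta>_def algebra_simps)
    then have "(1 / m) *\<^sub>R (m *\<^sub>R \<alpha>) = (1 / m) *\<^sub>R ((s + n) *\<^sub>R \<beta>)" by (rule arg_cong)
    with mn par(2)[of "(s + n) / m"] show False by simp
  qed
  have pos: "\<alpha> \<bullet> \<alpha> > 0" "\<beta> \<bullet> \<beta> > 0" "\<delta> \<bullet> \<delta> > 0"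
    using assms(1,2) \<delta>\<Phi> root_nonzero by simp_all
  have "\<exists>i :: int. cartan \<beta> \<gamma> = of_int i" "\<exists>i :: int. cartan \<beta> \<gamma> = - of_int i"
    if "\<beta> \<in> \<Phi>" "\<gamma> \<in> \<Phi>" for \<beta> \<gamma>
    using cartan_Ints[OF that] by (auto elim!: Ints_cases intro: exI[of _ "- _"])
  \<comment> \<open>The signs are chosen so that \<open>p\<close> and \<open>q\<close> come out
    nonnegative and the other four integers positive.\<close>
  with assms(1,2) \<delta>\<Phi> obtain p q x x' y y' :: int where ints: "cartan \<alpha> \<beta> = - of_int p" "cartan \<beta> \<alpha> = - of_int q"
    "cartan \<alpha> \<delta> = of_int x" "cartan \<delta> \<alpha> = of_int x'" "cartan \<beta> \<delta> = - of_int y" "cartan \<delta> \<beta> = - of_int y'"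
    by meson
  note inner = inner_commute[of \<beta> \<alpha>] inner_commute[of \<delta> \<alpha>] inner_commute[of \<delta> \<beta>]
  have dots: "2 * (\<alpha> \<bullet> \<beta>) = - of_int p * (\<alpha> \<bullet> \<alpha>)" "2 * (\<alpha> \<bullet> \<beta>) = - of_int q * (\<beta> \<bullet> \<beta>)"
    "2 * (\<alpha> \<bullet> \<delta>) = of_int x * (\<alpha> \<bullet> \<alpha>)" "2 * (\<alpha> \<bullet> \<delta>) = of_int x' * (\<delta> \<bullet> \<delta>)"
    "2 * (\<beta> \<bullet> \<delta>) = - of_int y * (\<beta> \<bullet> \<beta>)" "2 * (\<beta> \<bullet> \<delta>) = - of_int y' * (\<delta> \<bullet> \<delta>)"
    using ints pos by (simp_all add: cartan_def inner field_simps)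
  have \<alpha>\<delta>: "\<alpha> \<bullet> \<delta> = m * (\<alpha> \<bullet> \<alpha>) - n * (\<alpha> \<bullet> \<beta>)" and \<beta>\<delta>: "\<beta> \<bullet> \<delta> = m * (\<alpha> \<bullet> \<beta>) - n * (\<beta> \<bullet> \<beta>)"
    by (simp_all add: \<delta>_def inner_diff_right inner)
  have \<delta>\<delta>: "\<delta> \<bullet> \<delta> = m * (\<alpha> \<bullet> \<delta>) - n * (\<beta> \<bullet> \<delta>)"
    by (subst (1) \<delta>_def) (simp add: inner_diff_left)
  have "(of_int x - (2 * m + n * of_int p)) * (\<alpha> \<bullet> \<alpha>) = 0"
    using dots(1,3) \<alpha>\<delta> by (simp add: algebra_simps)
  then have x: "of_int x = 2 * m + n * of_int p" using pos by auto
  have "(of_int y - (2 * n + m * of_int q)) * (\<beta> \<bullet> \<beta>) = 0"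
    using dots(2,5) \<beta>\<delta> by (simp add: algebra_simps)
  then have y: "of_int y = 2 * n + m * of_int q" using pos by auto
  have "(2 - (m * of_int x' + n * of_int y')) * (\<delta> \<bullet> \<delta>) = 0"
  proof -
    have "2 * (\<delta> \<bullet> \<delta>) = m * (2 * (\<alpha> \<bullet> \<delta>)) - n * (2 * (\<beta> \<bullet> \<delta>))" using \<delta>\<delta> by simp
    also have "\<dots> = m * (of_int x' * (\<delta> \<bullet> \<delta>)) - n * (- of_int y' * (\<delta> \<bullet> \<delta>))"
      by (simp only: dots(4,6))
    finally show ?thesis by (simp add: algebra_simps)
  qed
  then have two: "2 = m * of_int x' + n * of_int y'" using pos by auto
  have "of_int p * (\<alpha> \<bullet> \<alpha>) \<ge> 0" "of_int q * (\<beta> \<bullet> \<beta>) \<ge> 0"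
    using dots(1,2) assms(5) by linarith+
  then have pq: "p \<ge> 0" "q \<ge> 0" using pos by (simp_all add: zero_le_mult_iff)
  have pq0: "p = 0 \<longleftrightarrow> q = 0"
    using dots(1,2) pos by auto
  have xy: "x > 0" "y > 0"
  proof -
    have "2 * m + n * of_int p > 0" "2 * n + m * of_int q > 0" using mn pq by (auto intro!: add_pos_nonneg)
    then show "x > 0" "y > 0" using x y by (metis of_int_0_less_iff)+
  qed
  have "of_int x' * (\<delta> \<bullet> \<delta>) > 0" "of_int y' * (\<delta> \<bullet> \<delta>) > 0"
    using dots(3-6) xy pos by (metis mult_pos_pos of_int_0_less_iff neg_equal_iff_equal minus_mult_left)+
  then have xy': "x' > 0" "y' > 0" using pos by (simp_all add: zero_less_mult_iff)
  have less: "of_int (p * q) < (4 :: real)" "of_int (x * x') < (4 :: real)" "of_int (y * y') < (4 :: real)"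
    using cartan_mult_less[OF assms(1,2,3,4)] cartan_mult_less[OF assms(1) \<delta>\<Phi>] cartan_mult_less[OF assms(2) \<delta>\<Phi>]
      ne\<alpha>[of 1] ne\<alpha>[of "-1"] ne\<beta>[of 1] ne\<beta>[of "-1"] ints by simp_all
  then have less: "p * q < 4" "x * x' < 4" "y * y' < 4" by linarith+
  \<comment> \<open>Cramer's rule for \<open>x = 2 * m + n * p\<close> and
    \<open>y = 2 * n + m * q\<close>; the determinant \<open>4 - p * q\<close> is positive.\<close>
  have m: "of_int (2 * x - p * y) = of_int (4 - p * q) * m" and n: "of_int (2 * y - q * x) = of_int (4 - p * q) * n"
    by (simp_all add: x y algebra_simps)
  have d4: "of_int (4 - p * q) > (0 :: real)" using less(1) by (simp only: of_int_0_less_iff)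
  then have "of_int (2 * x - p * y) > (0 :: real)" "of_int (2 * y - q * x) > (0 :: real)"
    unfolding m n using mn by simp_all
  then have c1: "2 * x - p * y > 0" "2 * y - q * x > 0" by linarith+
  have "of_int (2 * (4 - p * q)) = (of_int (4 - p * q) * 2 :: real)" by simp
  also have "\<dots> = of_int (x' * (2 * x - p * y) + y' * (2 * y - q * x))"
    unfolding of_int_add of_int_mult[of x'] of_int_mult[of y'] m n by (subst two) (simp add: algebra_simps)
  finally have c2: "2 * (4 - p * q) = x' * (2 * x - p * y) + y' * (2 * y - q * x)"
    by (simp only: of_int_eq_iff)
  \<comment> \<open>The product of the Cartan integers around the triangle \<alpha>, \<delta>,
    \<beta> is the same in both directions, since the squared lengths cancel.\<close>
  have "(of_int p * of_int x' * of_int y) * ((\<alpha> \<bullet> \<alpha>) * (\<delta> \<bullet> \<delta>) * (\<beta> \<bullet> \<beta>)) =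
      (of_int p * (\<alpha> \<bullet> \<alpha>)) * (of_int x' * (\<delta> \<bullet> \<delta>)) * (of_int y * (\<beta> \<bullet> \<beta>))" by (simp add: mult_ac)
  also have "\<dots> = (of_int q * (\<beta> \<bullet> \<beta>)) * (of_int x * (\<alpha> \<bullet> \<alpha>)) * (of_int y' * (\<delta> \<bullet> \<delta>))"
    using dots by (metis minus_mult_left neg_equal_iff_equal)
  also have "\<dots> = (of_int q * of_int y' * of_int x) * ((\<alpha> \<bullet> \<alpha>) * (\<delta> \<bullet> \<delta>) * (\<beta> \<bullet> \<beta>))" by (simp add: mult_ac)
  finally have "(of_int p * of_int x' * of_int y :: real) = of_int q * of_int y' * of_int x" using pos by simp
  then have c3: "p * x' * y = q * y' * x" by (simp only: of_int_mult[symmetric] of_int_eq_iff)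
  have half: "s *\<^sub>R \<alpha> - s *\<^sub>R \<beta> = s *\<^sub>R (\<alpha> - \<beta>)" for s by (simp add: scaleR_diff_right)
  from cartan_integer_cases[OF pq less(1) pq0 xy(1) xy'(1) less(2) xy(2) xy'(2) less(3) c1 c2 c3]
  consider (eq) "2 * x - p * y = 2 * y - q * x"
    | (1) "p = 0" "q = 0" "x = 1" "y = 3" "y' = 1" | (2) "p = 0" "q = 0" "x = 3" "y = 1" "x' = 1"
    | (3) "p = 0" "q = 0" "x = 1" "y = 2" "x' = 2" | (4) "p = 0" "q = 0" "x = 2" "y = 1" "y' = 2"
    by blast
  then show ?thesis
  proof cases
    case eq
    with m n d4 have "m = n" by (metis less_irrefl mult_left_cancel)
    with \<delta> half show ?thesis by metis
  next
    \<comment> \<open>This occurs in G2 with \<alpha> long and \<beta> short: the reflection in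
      \<delta> sends \<beta> to half of \<alpha> - \<beta>.\<close>
    case 1
    then have mn: "m = 1 / 2" "1 - n = - (1 / 2)" using x y by auto
    have "\<beta> + \<delta> = m *\<^sub>R \<alpha> + (1 - n) *\<^sub>R \<beta>" by (simp add: \<delta>_def algebra_simps)
    also have "\<dots> = (1 / 2) *\<^sub>R (\<alpha> - \<beta>)" unfolding mn by (simp add: scaleR_diff_right)
    finally have "\<beta> + \<delta> = (1 / 2) *\<^sub>R (\<alpha> - \<beta>)" .
    moreover have "\<beta> + \<delta> \<in> \<Phi>" using reflection_root[OF \<delta>\<Phi> assms(2)] ints 1 by simp
    ultimately show ?thesis by metis
  next
    case 2
    then have mn: "1 - m = - (1 / 2)" "n = 1 / 2" using x y by auto
    have "\<alpha> - \<delta> = (1 - m) *\<^sub>R \<alpha> + n *\<^sub>R \<beta>" by (simp add: \<delta>_def algebra_simps)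
    also have "\<dots> = (- (1 / 2)) *\<^sub>R (\<alpha> - \<beta>)" unfolding mn by (simp add: scaleR_diff_right)
    finally have "\<alpha> - \<delta> = (- (1 / 2)) *\<^sub>R (\<alpha> - \<beta>)" .
    moreover have "\<alpha> - \<delta> \<in> \<Phi>" using reflection_root[OF \<delta>\<Phi> assms(1)] ints 2 by simp
    ultimately show ?thesis by metis
  next
    \<comment> \<open>The reflection in \<delta> would send \<alpha> to the double of \<beta>, which
      is no root.\<close>
    case 3
    then have "m = 1 / 2" "n = 1" using x y by auto
    moreover have "\<alpha> - 2 *\<^sub>R \<delta> \<in> \<Phi>" using reflection_root[OF \<delta>\<Phi> assms(1)] ints 3 by simp
    ultimately have "2 *\<^sub>R \<beta> \<in> \<Phi>" by (simp add: \<delta>_def algebra_simps)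
    with parallel_root[OF assms(2)] show ?thesis by fastforce
  next
    case 4
    then have "m = 1" "n = 1 / 2" using x y by auto
    moreover have "\<beta> + 2 *\<^sub>R \<delta> \<in> \<Phi>" using reflection_root[OF \<delta>\<Phi> assms(2)] ints 4 by simp
    ultimately have "2 *\<^sub>R \<alpha> \<in> \<Phi>" by (simp add: \<delta>_def algebra_simps)
    with parallel_root[OF assms(1)] show ?thesis by fastforce
  qed
qed

end

section \<open>Vertices with tied best neighbours\<close>

lemma orthogonal_to_hyperplane_parallel:
  fixes d k :: "'a::euclidean_space"
  assumes "\<And>x. x \<bullet> d = 0 \<Longrightarrow> x \<bullet> k = 0"
  obtains s where "k = s *\<^sub>R d"
proof (cases "d = 0")
  case True
  with assms[of k] that show thesis by simp
next
  case False
  define s where "s = (k \<bullet> d) / (d \<bullet> d)"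
  have "(k - s *\<^sub>R d) \<bullet> d = 0" using False by (simp add: s_def inner_diff_left)
  moreover from assms[OF this] have "(k - s *\<^sub>R d) \<bullet> k = 0" .
  ultimately have "(k - s *\<^sub>R d) \<bullet> (k - s *\<^sub>R d) = 0" by (simp add: inner_diff_right[of _ k])
  then have "k = s *\<^sub>R d" by simp
  then show thesis by (rule that)
qed

context crystallographic_roots
begin

text \<open>The facet point is \<open>w - t *\<^sub>R g\<close>, with \<open>g\<close> the part of
  \<beta> orthogonal to \<alpha>. At a root m \<alpha> + n \<beta> of the plane other than \<alpha>
  and -\<alpha> it has the sign of -n. Because m n \<ge> 0, this is opposite to the sign of m + n,
  hence to that of \<open>e\<close>, and so it is the sign of \<open>f\<close>. Off the plane
  \<open>w\<close> decides both signs.\<close>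

lemma wall_of_plane:
  assumes \<alpha>\<beta>: "\<alpha> \<in> \<Phi>" "\<beta> \<in> \<Phi>" "\<beta> \<noteq> \<alpha>" "\<beta> \<noteq> - \<alpha>"
    and h: "e \<bullet> \<alpha> = h" "e \<bullet> \<beta> = h" "h > 0" and f: "f \<bullet> \<alpha> < 0"
    and w: "w \<bullet> \<alpha> = 0" "w \<bullet> \<beta> = 0"
    and off: "\<And>\<delta>. \<delta> \<in> \<Phi> \<Longrightarrow> w \<bullet> \<delta> \<noteq> 0 \<Longrightarrow> sgn (f \<bullet> \<delta>) = sgn (w \<bullet> \<delta>)"
    and on: "\<And>\<delta>. \<delta> \<in> \<Phi> \<Longrightarrow> w \<bullet> \<delta> = 0 \<Longrightarrow> sgn (f \<bullet> \<delta>) = - sgn (e \<bullet> \<delta>)"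
    and plane: "\<And>\<delta>. \<delta> \<in> \<Phi> \<Longrightarrow> w \<bullet> \<delta> = 0 \<Longrightarrow> \<exists>m n. \<delta> = m *\<^sub>R \<alpha> + n *\<^sub>R \<beta> \<and> m * n \<ge> 0"
  shows "wall f \<alpha>"
proof -
  define g where "g = \<beta> - ((\<alpha> \<bullet> \<beta>) / (\<alpha> \<bullet> \<alpha>)) *\<^sub>R \<alpha>"
  have aa: "\<alpha> \<bullet> \<alpha> > 0" using root_nonzero[OF \<alpha>\<beta>(1)] by simp
  have g\<alpha>: "g \<bullet> \<alpha> = 0" using aa by (subst inner_commute) (simp add: g_def inner_diff_right)
  have g\<beta>: "g \<bullet> \<beta> > 0"
    using strict_Cauchy_Schwarz_roots[OF \<alpha>\<beta>] aa
    by (simp add: g_def inner_diff_left field_simps)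
  obtain t where t: "t > 0" "\<And>k. k \<in> \<Phi> \<Longrightarrow> w \<bullet> k \<noteq> 0 \<Longrightarrow> sgn ((w + t *\<^sub>R (- g)) \<bullet> k) = sgn (w \<bullet> k)"
    using exists_sgn_inner_perturb[OF finite_roots, of w "- g"] by metis
  have "sgn ((w + t *\<^sub>R (- g)) \<bullet> \<delta>) = sgn (f \<bullet> \<delta>)" if \<delta>: "\<delta> \<in> \<Phi> - {\<alpha>, - \<alpha>}" for \<delta>
  proof (cases "w \<bullet> \<delta> = 0")
    case False
    with t(2)[of \<delta>] off[of \<delta>] \<delta> show ?thesis by simp
  next
    case True
    obtain m n where mn: "\<delta> = m *\<^sub>R \<alpha> + n *\<^sub>R \<beta>" "m * n \<ge> 0" using plane True \<delta> by blast
    have "n \<noteq> 0"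
    proof
      assume "n = 0"
      with mn parallel_root[OF \<alpha>\<beta>(1), of m] \<delta> show False by auto
    qed
    then have "sgn (m + n) = sgn n" using mn(2) by (auto simp: zero_le_mult_iff sgn_if)
    moreover have "e \<bullet> \<delta> = (m + n) * h" by (simp add: mn(1) inner_add_right h algebra_simps)
    moreover have "(w + t *\<^sub>R (- g)) \<bullet> \<delta> = - (t * (n * (g \<bullet> \<beta>)))"
      using True by (simp add: inner_diff_left) (simp add: mn(1) inner_add_right g\<alpha>)
    ultimately show ?thesis using on[of \<delta>] True \<delta> h(3) t(1) g\<beta>
      by (simp add: sgn_mult sgn_minus)
  qed
  moreover have "(w + t *\<^sub>R (- g)) \<bullet> \<alpha> = 0" by (simp add: inner_diff_left w(1) g\<alpha>)
  ultimately show ?thesis using \<alpha>\<beta>(1) f unfolding wall_def by blast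
qed

text \<open>Let \<open>w\<close> be the projection of \<open>e\<close> to the space orthogonal to \<open>\<alpha>\<close> and \<open>\<beta>\<close>, and take \<open>f\<close> near \<open>w\<close>.
  As \<open>\<alpha> \<bullet> \<beta> \<le> 0\<close>, one has \<open>e = w + x \<alpha> + y \<beta>\<close> with \<open>x, y > 0\<close>, while every other wall \<open>\<delta>\<close>
  satisfies \<open>\<delta> \<bullet> \<alpha> \<le> 0\<close>, \<open>\<delta> \<bullet> \<beta> \<le> 0\<close> and \<open>w \<bullet> \<delta> \<le> 0\<close>.\<close>

lemma two_tied_walls:
  assumes \<alpha>\<beta>: "\<alpha> \<in> \<Phi>" "\<beta> \<in> \<Phi>" "\<beta> \<noteq> \<alpha>" and e: "e \<bullet> \<alpha> = e \<bullet> \<beta>" "e \<bullet> \<alpha> > 0"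
    and nopar: "\<And>s. s *\<^sub>R (\<alpha> - \<beta>) \<notin> \<Phi>"
    and e_roots: "\<And>\<delta>. \<delta> \<in> \<Phi> \<Longrightarrow> e \<bullet> \<delta> \<noteq> 0"
    and z: "\<And>\<delta>. \<delta> \<in> \<Phi> \<Longrightarrow> \<delta> - z \<delta> \<in> span {\<alpha>, \<beta>} \<and> z \<delta> \<bullet> \<alpha> = 0 \<and> z \<delta> \<bullet> \<beta> = 0"
    and e_z: "\<And>\<delta>. \<delta> \<in> \<Phi> \<Longrightarrow> z \<delta> \<noteq> 0 \<Longrightarrow> e \<bullet> z \<delta> \<noteq> 0"
  obtains f where "regular f" "wall f \<alpha>" "wall f \<beta>"
    "\<And>\<delta>. wall f \<delta> \<Longrightarrow> \<delta> \<noteq> \<alpha> \<Longrightarrow> \<delta> \<noteq> \<beta> \<Longrightarrow> e \<bullet> \<delta> < 0"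
proof -
  define h where "h = e \<bullet> \<alpha>"
  have h: "e \<bullet> \<alpha> = h" "e \<bullet> \<beta> = h" "h > 0" using e by (auto simp: h_def)
  have ne: "\<beta> \<noteq> - \<alpha>"
  proof
    assume "\<beta> = - \<alpha>"
    then have "(1/2) *\<^sub>R (\<alpha> - \<beta>) = \<alpha>" using scaleR_2[of \<alpha>] by simp
    with nopar[of "1/2"] \<alpha>\<beta>(1) show False by simp
  qed
  have obt: "\<alpha> \<bullet> \<beta> \<le> 0"
    using diff_root[OF \<alpha>\<beta>(1,2)] \<alpha>\<beta>(3) nopar[of 1] by force
  have span2: "\<exists>m n. x = m *\<^sub>R \<alpha> + n *\<^sub>R \<beta>" if "x \<in> span {\<alpha>, \<beta>}" for x
  proof -
    obtain m where "x - m *\<^sub>R \<alpha> \<in> span {\<beta>}" using span_breakdown_eq[of x \<alpha> "{\<beta>}"] \<open>x \<in> _\<close> by auto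
    then obtain n where "x - m *\<^sub>R \<alpha> - n *\<^sub>R \<beta> \<in> span {}" using span_breakdown_eq[of _ \<beta> "{}"] by auto
    then have "x = m *\<^sub>R \<alpha> + n *\<^sub>R \<beta>" by (simp add: algebra_simps)
    then show ?thesis by blast
  qed
  obtain v w where vw: "v \<in> span {\<alpha>, \<beta>}" "\<And>u. u \<in> span {\<alpha>, \<beta>} \<Longrightarrow> orthogonal w u" "e = v + w"
    using orthogonal_subspace_decomp_exists[of "{\<alpha>, \<beta>}" e] by metis
  have w: "w \<bullet> \<alpha> = 0" "w \<bullet> \<beta> = 0"
    using vw(2) by (auto simp: orthogonal_def span_base)
  obtain x y where xy: "v = x *\<^sub>R \<alpha> + y *\<^sub>R \<beta>" using span2[OF vw(1)] by blast
  have eq1: "x * (\<alpha> \<bullet> \<alpha>) + y * (\<alpha> \<bullet> \<beta>) = h" and eq2: "x * (\<alpha> \<bullet> \<beta>) + y * (\<beta> \<bullet> \<beta>) = h"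
    using h(1,2) w by (auto simp: vw(3) xy inner_add_left inner_commute[of \<beta> \<alpha>])
  have D: "(\<alpha> \<bullet> \<alpha>) * (\<beta> \<bullet> \<beta>) - (\<alpha> \<bullet> \<beta>) * (\<alpha> \<bullet> \<beta>) > 0"
    using strict_Cauchy_Schwarz_roots[OF \<alpha>\<beta> ne] by simp
  have pos: "\<alpha> \<bullet> \<alpha> > 0" "\<beta> \<bullet> \<beta> > 0" using root_nonzero \<alpha>\<beta> by simp_all
  have diff_pos: "\<beta> \<bullet> \<beta> - \<alpha> \<bullet> \<beta> > 0" "\<alpha> \<bullet> \<alpha> - \<alpha> \<bullet> \<beta> > 0"
    using pos obt by linarith+
  \<comment> \<open>Cramer's rule with the Gram determinant; the right side is positive because
    \<alpha> \<bullet> \<beta> \<le> 0.\<close>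
  have "x * ((\<alpha> \<bullet> \<alpha>) * (\<beta> \<bullet> \<beta>) - (\<alpha> \<bullet> \<beta>) * (\<alpha> \<bullet> \<beta>)) =
      (x * (\<alpha> \<bullet> \<alpha>) + y * (\<alpha> \<bullet> \<beta>)) * (\<beta> \<bullet> \<beta>) - (x * (\<alpha> \<bullet> \<beta>) + y * (\<beta> \<bullet> \<beta>)) * (\<alpha> \<bullet> \<beta>)"
    by (simp add: algebra_simps)
  also have "\<dots> = h * (\<beta> \<bullet> \<beta> - \<alpha> \<bullet> \<beta>)" unfolding eq1 eq2 by (simp add: algebra_simps)
  also have "\<dots> > 0" using h(3) diff_pos by (intro mult_pos_pos)
  finally have "x > 0" using D by (simp add: zero_less_mult_iff)
  have "y * ((\<alpha> \<bullet> \<alpha>) * (\<beta> \<bullet> \<beta>) - (\<alpha> \<bullet> \<beta>) * (\<alpha> \<bullet> \<beta>)) =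
      (x * (\<alpha> \<bullet> \<beta>) + y * (\<beta> \<bullet> \<beta>)) * (\<alpha> \<bullet> \<alpha>) - (x * (\<alpha> \<bullet> \<alpha>) + y * (\<alpha> \<bullet> \<beta>)) * (\<alpha> \<bullet> \<beta>)"
    by (simp add: algebra_simps)
  also have "\<dots> = h * (\<alpha> \<bullet> \<alpha> - \<alpha> \<bullet> \<beta>)" unfolding eq1 eq2 by (simp add: algebra_simps)
  also have "\<dots> > 0" using h(3) diff_pos by (intro mult_pos_pos)
  finally have "y > 0" using D by (simp add: zero_less_mult_iff)
  \<comment> \<open>A root orthogonal to \<open>w\<close> has a component off the plane that is
    orthogonal to \<open>e\<close>; by \<open>e_z\<close> this component is 0, so the root lies in
    the plane.\<close>
  have plane: "\<exists>m n. \<delta> = m *\<^sub>R \<alpha> + n *\<^sub>R \<beta> \<and> m * n \<ge> 0" if \<delta>: "\<delta> \<in> \<Phi>" "w \<bullet> \<delta> = 0" for \<delta>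
  proof -
    have "w \<bullet> (\<delta> - z \<delta>) = 0" using vw(2) z[OF \<delta>(1)] by (auto simp: orthogonal_def)
    moreover have "v \<bullet> z \<delta> = 0" using z[OF \<delta>(1)] by (subst inner_commute) (simp add: xy inner_add_right)
    ultimately have "e \<bullet> z \<delta> = 0" using \<delta>(2) by (simp add: vw(3) inner_add_left inner_diff_right)
    with e_z[OF \<delta>(1)] have "z \<delta> = 0" by blast
    with z[OF \<delta>(1)] have "\<delta> \<in> span {\<alpha>, \<beta>}" by simp
    then obtain m n where mn: "\<delta> = m *\<^sub>R \<alpha> + n *\<^sub>R \<beta>" using span2 by blast
    have "m * n \<ge> 0"
    proof (rule ccontr)
      assume "\<not> m * n \<ge> 0"
      then consider "m > 0" "- n > 0" | "- m > 0" "n > 0" by (auto simp: zero_le_mult_iff)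
      then show False
      proof cases
        case 1
        have "m *\<^sub>R \<alpha> - (- n) *\<^sub>R \<beta> \<in> \<Phi>" using \<delta>(1) by (simp add: mn)
        from opposite_sign_root[OF \<alpha>\<beta> ne obt 1 this] nopar show False by blast
      next
        case 2
        have "(- m) *\<^sub>R \<alpha> - n *\<^sub>R \<beta> \<in> \<Phi>" using uminus_root[OF \<delta>(1)] by (simp add: mn)
        from opposite_sign_root[OF \<alpha>\<beta> ne obt 2 this] nopar show False by blast
      qed
    qed
    with mn show ?thesis by blast
  qed
  obtain t where t: "t > 0" "\<And>k. k \<in> \<Phi> \<Longrightarrow> w \<bullet> k \<noteq> 0 \<Longrightarrow> sgn ((w + t *\<^sub>R (- e)) \<bullet> k) = sgn (w \<bullet> k)"
    using exists_sgn_inner_perturb[OF finite_roots, of w "- e"] by metis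
  \<comment> \<open>Subtracting a little of \<open>e\<close> makes \<alpha> and \<beta>, which are
    positive on \<open>e\<close> and vanish on \<open>w\<close>, negative on
    \<open>f\<close>.\<close>
  define f where "f = w + t *\<^sub>R (- e)"
  have off: "sgn (f \<bullet> \<delta>) = sgn (w \<bullet> \<delta>)" if "\<delta> \<in> \<Phi>" "w \<bullet> \<delta> \<noteq> 0" for \<delta>
    using t(2) that by (simp add: f_def)
  have on: "sgn (f \<bullet> \<delta>) = - sgn (e \<bullet> \<delta>)" if "w \<bullet> \<delta> = 0" for \<delta>
    using t(1) that by (simp add: f_def inner_diff_left sgn_minus sgn_mult)
  have "regular f"
    unfolding regular_def
  proof
    fix \<delta> assume \<delta>: "\<delta> \<in> \<Phi>"
    show "f \<bullet> \<delta> \<noteq> 0"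
      by (cases "w \<bullet> \<delta> = 0") (use on[of \<delta>] off[OF \<delta>] e_roots[OF \<delta>] in \<open>auto simp: sgn_0_0\<close>)
  qed
  have f: "f \<bullet> \<alpha> < 0" "f \<bullet> \<beta> < 0"
    using on[OF w(1)] on[OF w(2)] h by (simp_all add: sgn_1_neg)
  have "wall f \<alpha>"
    using wall_of_plane[OF \<alpha>\<beta> ne h f(1) w off on plane] by blast
  have ne': "\<alpha> \<noteq> - \<beta>" using ne by auto
  have plane': "\<exists>m n. \<delta> = m *\<^sub>R \<beta> + n *\<^sub>R \<alpha> \<and> m * n \<ge> 0" if \<delta>: "\<delta> \<in> \<Phi>" "w \<bullet> \<delta> = 0" for \<delta>
  proof -
    obtain m n where "\<delta> = m *\<^sub>R \<alpha> + n *\<^sub>R \<beta>" "m * n \<ge> 0" using plane[OF \<delta>] by blast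
    then show ?thesis by (intro exI[of _ n] exI[of _ m]) (simp add: add.commute mult.commute)
  qed
  have "wall f \<beta>"
    using wall_of_plane[OF \<alpha>\<beta>(2,1) \<alpha>\<beta>(3)[symmetric] ne' h(2,1,3) f(2) w(2,1) off on plane'] by blast
  have "e \<bullet> \<delta> < 0" if \<delta>: "wall f \<delta>" "\<delta> \<noteq> \<alpha>" "\<delta> \<noteq> \<beta>" for \<delta>
  proof -
    have \<delta>\<Phi>: "\<delta> \<in> \<Phi>" "f \<bullet> \<delta> < 0" using \<delta>(1) by (auto simp: wall_def)
    have le: "\<alpha> \<bullet> \<delta> \<le> 0" "\<beta> \<bullet> \<delta> \<le> 0"
      using wall_inner_nonpos[OF \<open>regular f\<close> \<delta>(1)] \<open>wall f \<alpha>\<close> \<open>wall f \<beta>\<close> \<delta> by (auto simp: inner_commute)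
    show ?thesis
    proof (cases "w \<bullet> \<delta> = 0")
      case False
      then have "w \<bullet> \<delta> < 0" using off[OF \<delta>\<Phi>(1)] \<delta>\<Phi>(2) by (simp add: sgn_if split: if_splits)
      moreover have "e \<bullet> \<delta> = x * (\<alpha> \<bullet> \<delta>) + y * (\<beta> \<bullet> \<delta>) + w \<bullet> \<delta>"
        by (simp add: vw(3) xy inner_add_left)
      moreover have "x * (\<alpha> \<bullet> \<delta>) \<le> 0" "y * (\<beta> \<bullet> \<delta>) \<le> 0"
        using le \<open>x > 0\<close> \<open>y > 0\<close> by (simp_all add: mult_nonneg_nonpos)
      ultimately show ?thesis by linarith
    next
      case True
      obtain m n where mn: "\<delta> = m *\<^sub>R \<alpha> + n *\<^sub>R \<beta>" "m * n \<ge> 0" using plane[OF \<delta>\<Phi>(1) True] by blast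
      \<comment> \<open>A further wall inside the plane would be a nonnegative combination of
        \<alpha> and \<beta> with nonpositive products with both, hence with itself.\<close>
      have "e \<bullet> \<delta> > 0" using on[OF True] \<delta>\<Phi>(2) by (simp add: sgn_if split: if_splits)
      also have "e \<bullet> \<delta> = (m + n) * h" by (simp add: mn(1) inner_add_right h algebra_simps)
      finally have "m + n > 0" using h(3) by (simp add: zero_less_mult_iff)
      with mn(2) have "m \<ge> 0" "n \<ge> 0" by (auto simp: zero_le_mult_iff)
      then have "m * (\<alpha> \<bullet> \<delta>) + n * (\<beta> \<bullet> \<delta>) \<le> 0"
        using le by (simp add: add_nonpos_nonpos mult_nonneg_nonpos)
      moreover have "\<delta> \<bullet> \<delta> = m * (\<alpha> \<bullet> \<delta>) + n * (\<beta> \<bullet> \<delta>)"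
        by (subst (1) mn(1)) (simp add: inner_add_left)
      moreover have "\<delta> \<bullet> \<delta> > 0" using root_nonzero[OF \<delta>\<Phi>(1)] by simp
      ultimately show ?thesis by linarith
    qed
  qed
  with that \<open>regular f\<close> \<open>wall f \<alpha>\<close> \<open>wall f \<beta>\<close> show thesis by blast
qed

text \<open>The value 0 stands for staying at the vertex, so that it competes with the genuine
  moves.\<close>

definition step :: "'a \<Rightarrow> 'a \<Rightarrow> bool" where
  "step f \<delta> \<longleftrightarrow> \<delta> = 0 \<or> wall f \<delta>"

lemma tied_steps:
  assumes \<alpha>\<beta>: "\<alpha> \<in> \<Phi>" "\<beta> \<in> \<Phi>" "\<beta> \<noteq> \<alpha>" and e: "e \<bullet> (\<alpha> - \<beta>) = 0"
    and e_roots: "\<And>\<delta>. \<delta> \<in> \<Phi> \<Longrightarrow> \<nexists>s. \<delta> = s *\<^sub>R (\<alpha> - \<beta>) \<Longrightarrow> e \<bullet> \<delta> \<noteq> 0"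
    and z: "\<And>\<delta>. \<delta> \<in> \<Phi> \<Longrightarrow> \<delta> - z \<delta> \<in> span {\<alpha>, \<beta>} \<and> z \<delta> \<bullet> \<alpha> = 0 \<and> z \<delta> \<bullet> \<beta> = 0"
    and e_z: "\<And>\<delta>. \<delta> \<in> \<Phi> \<Longrightarrow> z \<delta> \<noteq> 0 \<Longrightarrow> e \<bullet> z \<delta> \<noteq> 0"
  obtains f \<mu> \<nu> s where "regular f" "step f \<mu>" "step f \<nu>" "s \<noteq> 0" "\<mu> - \<nu> = s *\<^sub>R (\<alpha> - \<beta>)"
    "\<And>\<delta>. step f \<delta> \<Longrightarrow> \<delta> \<noteq> \<mu> \<Longrightarrow> \<delta> \<noteq> \<nu> \<Longrightarrow> e \<bullet> \<delta> < e \<bullet> \<mu>"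
proof (cases "\<exists>s. s *\<^sub>R (\<alpha> - \<beta>) \<in> \<Phi>")
  case True
  then obtain s where s: "s *\<^sub>R (\<alpha> - \<beta>) \<in> \<Phi>" by blast
  define \<gamma> where "\<gamma> = s *\<^sub>R (\<alpha> - \<beta>)"
  have \<gamma>: "\<gamma> \<in> \<Phi>" "e \<bullet> \<gamma> = 0" using s e by (auto simp: \<gamma>_def)
  have "s \<noteq> 0" using root_nonzero[OF s] by auto
  have e0: "e \<bullet> \<delta> \<noteq> 0" if \<delta>: "\<delta> \<in> \<Phi> - {\<gamma>, - \<gamma>}" for \<delta>
  proof (rule e_roots)
    show "\<nexists>r. \<delta> = r *\<^sub>R (\<alpha> - \<beta>)"
    proof
      assume "\<exists>r. \<delta> = r *\<^sub>R (\<alpha> - \<beta>)"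
      then obtain r where "\<delta> = r *\<^sub>R (\<alpha> - \<beta>)" by blast
      then have "\<delta> = (r / s) *\<^sub>R \<gamma>" using \<open>s \<noteq> 0\<close> by (simp add: \<gamma>_def)
      with parallel_root[OF \<gamma>(1), of "r / s"] \<delta> show False by auto
    qed
  qed (use \<delta> in auto)
  obtain t where t: "t > 0" "\<And>k. k \<in> \<Phi> \<Longrightarrow> e \<bullet> k \<noteq> 0 \<Longrightarrow> sgn ((e + t *\<^sub>R (- \<gamma>)) \<bullet> k) = sgn (e \<bullet> k)"
    using exists_sgn_inner_perturb[OF finite_roots, of e "- \<gamma>"] by metis
  \<comment> \<open>A point just beyond the hyperplane of \<gamma>: every other wall of its chamber
    is negative on \<open>e\<close>, so only \<gamma> can tie with staying.\<close>
  define f where "f = e + t *\<^sub>R (- \<gamma>)"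
  have sg: "sgn (e \<bullet> \<delta>) = sgn (f \<bullet> \<delta>)" if "\<delta> \<in> \<Phi> - {\<gamma>, - \<gamma>}" for \<delta>
    using t(2)[of \<delta>] e0[OF that] that by (simp add: f_def)
  have f\<gamma>: "f \<bullet> \<gamma> < 0" using \<gamma> t(1) root_nonzero[OF \<gamma>(1)] by (simp add: f_def inner_diff_left)
  have "regular f"
    unfolding regular_def
  proof
    fix \<delta> assume \<delta>: "\<delta> \<in> \<Phi>"
    show "f \<bullet> \<delta> \<noteq> 0"
    proof (cases "\<delta> \<in> {\<gamma>, - \<gamma>}")
      case True
      then show ?thesis using f\<gamma> by auto
    next
      case False
      with sg[of \<delta>] e0[of \<delta>] \<delta> show ?thesis by (metis DiffI sgn_0_0)
    qed
  qed
  moreover have "step f \<gamma>" using \<gamma> f\<gamma> sg by (auto simp: step_def wall_def)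
  moreover have "step f 0" by (simp add: step_def)
  moreover have "\<gamma> - 0 = s *\<^sub>R (\<alpha> - \<beta>)" by (simp add: \<gamma>_def)
  moreover have "e \<bullet> \<delta> < e \<bullet> \<gamma>" if \<delta>: "step f \<delta>" "\<delta> \<noteq> \<gamma>" "\<delta> \<noteq> 0" for \<delta>
  proof -
    have "\<delta> \<in> \<Phi>" "f \<bullet> \<delta> < 0" using \<delta> by (auto simp: step_def wall_def)
    moreover from this f\<gamma> have "\<delta> \<noteq> - \<gamma>" by auto
    ultimately have "sgn (e \<bullet> \<delta>) = -1" using sg[of \<delta>] \<delta>(2) by simp
    then show ?thesis using \<gamma>(2) by (simp add: sgn_1_neg)
  qed
  ultimately show thesis using that \<open>s \<noteq> 0\<close> by blast
next
  case False
  note witness = that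
  from False have nopar: "s *\<^sub>R (\<alpha> - \<beta>) \<notin> \<Phi>" for s by blast
  then have e_roots': "e \<bullet> \<delta> \<noteq> 0" if "\<delta> \<in> \<Phi>" for \<delta> using e_roots[OF that] that by blast
  \<comment> \<open>The pair will be (\<alpha>, \<beta>) or (-\<alpha>, -\<beta>), whichever is
    positive on \<open>e\<close>; only then does it beat the step 0.\<close>
  have main: thesis if \<mu>\<nu>: "\<mu> \<in> \<Phi>" "\<nu> \<in> \<Phi>" "\<nu> \<noteq> \<mu>" "e \<bullet> \<mu> > 0" "r \<noteq> 0" "\<mu> - \<nu> = r *\<^sub>R (\<alpha> - \<beta>)"
    and z': "\<And>\<delta>. \<delta> \<in> \<Phi> \<Longrightarrow> \<delta> - z \<delta> \<in> span {\<mu>, \<nu>} \<and> z \<delta> \<bullet> \<mu> = 0 \<and> z \<delta> \<bullet> \<nu> = 0" for \<mu> \<nu> r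
  proof -
    have "e \<bullet> (\<mu> - \<nu>) = 0" using e \<mu>\<nu>(6) by simp
    then have eq: "e \<bullet> \<mu> = e \<bullet> \<nu>" by (simp add: inner_diff_right)
    have "s *\<^sub>R (\<mu> - \<nu>) \<notin> \<Phi>" for s using nopar[of "s * r"] by (simp add: \<mu>\<nu>(6))
    from two_tied_walls[OF \<mu>\<nu>(1-3) eq \<mu>\<nu>(4) this e_roots' z' e_z]
    obtain f where f: "regular f" "wall f \<mu>" "wall f \<nu>"
      "\<And>\<delta>. wall f \<delta> \<Longrightarrow> \<delta> \<noteq> \<mu> \<Longrightarrow> \<delta> \<noteq> \<nu> \<Longrightarrow> e \<bullet> \<delta> < 0" by blast
    have "e \<bullet> \<delta> < e \<bullet> \<mu>" if "step f \<delta>" "\<delta> \<noteq> \<mu>" "\<delta> \<noteq> \<nu>" for \<delta>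
      using that \<mu>\<nu>(4) f(4)[of \<delta>] by (auto simp: step_def)
    with f \<mu>\<nu> show thesis by (intro witness[of f \<mu> \<nu> r]) (auto simp: step_def)
  qed
  have "e \<bullet> \<alpha> \<noteq> 0" using e_roots' \<alpha>\<beta> by simp
  then consider "e \<bullet> \<alpha> > 0" | "e \<bullet> (- \<alpha>) > 0" by fastforce
  then show thesis
  proof cases
    case 1
    with main[of \<alpha> \<beta> 1] \<alpha>\<beta> z show thesis by simp
  next
    case 2
    have "- (- \<alpha>) \<in> span {- \<alpha>, - \<beta>}" "- (- \<beta>) \<in> span {- \<alpha>, - \<beta>}"
      by (intro span_neg span_base; simp)+
    then have "span {\<alpha>, \<beta>} \<subseteq> span {- \<alpha>, - \<beta>}" by (intro span_minimal) auto
    then have "\<delta> - z \<delta> \<in> span {- \<alpha>, - \<beta>} \<and> z \<delta> \<bullet> (- \<alpha>) = 0 \<and> z \<delta> \<bullet> (- \<beta>) = 0" if "\<delta> \<in> \<Phi>" for \<delta>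
      using z[OF that] by auto
    with 2 main[of "- \<alpha>" "- \<beta>" "-1"] \<alpha>\<beta> show thesis by (simp add: uminus_root)
  qed
qed

end

section \<open>Greatest-improvement arborescences\<close>

text \<open>Each application before reaching \<open>r\<close> lowers the number of elements with
  larger potential.\<close>

lemma funpow_reaches_by_increase:
  fixes \<phi> :: "'a \<Rightarrow> real"
  assumes "finite V" "B \<in> V \<rightarrow> V" "\<And>v. v \<in> V \<Longrightarrow> v \<noteq> r \<Longrightarrow> \<phi> v < \<phi> (B v)" "v \<in> V"
  shows "\<exists>k. (B ^^ k) v = r"
  using \<open>v \<in> V\<close>
proof (induction "card {u \<in> V. \<phi> v < \<phi> u}" arbitrary: v rule: less_induct)
  case less
  show ?case
  proof (cases "v = r")
    case True
    then show ?thesis by (intro exI[of _ 0]) simp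
  next
    case False
    have inc: "\<phi> v < \<phi> (B v)" and Bv: "B v \<in> V" using assms(2,3) less.prems False by auto
    have "card {u \<in> V. \<phi> (B v) < \<phi> u} < card {u \<in> V. \<phi> v < \<phi> u}"
      by (rule psubset_card_mono) (use inc Bv assms(1) in auto)
    from less.hyps[OF this Bv] obtain k where "(B ^^ k) (B v) = r" by blast
    then have "(B ^^ Suc k) v = r" by (simp only: funpow_Suc_right comp_apply)
    then show ?thesis by blast
  qed
qed

context crystallographic_roots
begin

lemma adjacent_vertex: "adjacent Z u v \<Longrightarrow> u \<in> vertices Z"
  unfolding adjacent_def edge_of_def vertices_def
  using extreme_point_of_face extreme_point_of_segment by blast

definition neighbours :: "'a \<Rightarrow> 'a set" where
  "neighbours v = insert v {u. adjacent Z u v}"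

lemma neighbours_vertices: "v \<in> vertices Z \<Longrightarrow> neighbours v \<subseteq> vertices Z"
  using adjacent_vertex by (auto simp: neighbours_def)

lemma neighbours_top_vertex:
  assumes "regular f"
  shows "neighbours (top_vertex f) = (\<lambda>\<delta>. top_vertex f + 2 *\<^sub>R \<delta>) ` {\<delta>. step f \<delta>}"
  unfolding neighbours_def adjacent_top_vertex_iff[OF assms] step_def by auto

lemma step_root: "step f \<delta> \<Longrightarrow> \<delta> \<in> insert 0 \<Phi>"
  by (auto simp: step_def wall_def)

text \<open>The vertex itself is among the candidates, so a local maximum is a fixed point. Ties are
  broken arbitrarily; for generic \<open>c\<close> there are none.\<close>

definition greatest_improvement :: "'a \<Rightarrow> 'a \<Rightarrow> 'a" where
  "greatest_improvement c v = (SOME u. u \<in> neighbours v \<and> (\<forall>x\<in>neighbours v. c \<bullet> x \<le> c \<bullet> u))"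

lemma greatest_improvement:
  assumes "v \<in> vertices Z"
  shows "greatest_improvement c v \<in> neighbours v"
    "x \<in> neighbours v \<Longrightarrow> c \<bullet> x \<le> c \<bullet> greatest_improvement c v"
proof -
  have "finite (neighbours v)" "neighbours v \<noteq> {}"
    using finite_subset[OF neighbours_vertices[OF assms] finite_vertices] by (auto simp: neighbours_def)
  then have "\<exists>u. u \<in> neighbours v \<and> (\<forall>x\<in>neighbours v. c \<bullet> x \<le> c \<bullet> u)"
    by (metis finite_maximizer[of "neighbours v" "\<lambda>x. c \<bullet> x"])
  from someI_ex[OF this] show "greatest_improvement c v \<in> neighbours v"
    "x \<in> neighbours v \<Longrightarrow> c \<bullet> x \<le> c \<bullet> greatest_improvement c v"
    by (auto simp: greatest_improvement_def)
qed

definition generic :: "'a \<Rightarrow> bool" where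
  "generic c \<longleftrightarrow> (\<forall>d\<in>differences \<Phi>. c \<bullet> d \<noteq> 0)"

lemma double_root_difference:
  assumes "\<alpha> \<in> \<Phi>"
  shows "2 *\<^sub>R \<alpha> \<in> differences \<Phi>"
  unfolding differences_def using assms uminus_root[OF assms] root_neq_uminus[OF assms]
  by (intro CollectI exI[of _ \<alpha>] exI[of _ "- \<alpha>"]) (simp add: scaleR_2)

lemma generic_imp_regular: "generic c \<Longrightarrow> regular c"
  using double_root_difference by (force simp: generic_def regular_def)

text \<open>Two neighbours differ by 2 (\<beta> - \<gamma>). If one of them is the vertex itself,
  this is twice a root, which is the difference of that root and its negative.\<close>

lemma neighbours_difference:
  assumes "v \<in> vertices Z" "x \<in> neighbours v" "y \<in> neighbours v" "x \<noteq> y"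
  obtains k d where "k > 0" "d \<in> differences \<Phi>" "x - y = k *\<^sub>R d"
proof -
  obtain f where f: "regular f" "v = top_vertex f" using assms(1) by (auto simp: vertices_Z)
  obtain \<beta> \<gamma> where \<beta>\<gamma>: "\<beta> \<in> insert 0 \<Phi>" "\<gamma> \<in> insert 0 \<Phi>" "x = v + 2 *\<^sub>R \<beta>" "y = v + 2 *\<^sub>R \<gamma>"
    using assms(2,3) step_root unfolding f(2) neighbours_top_vertex[OF f(1)] by blast
  have xy: "x - y = 2 *\<^sub>R (\<beta> - \<gamma>)" by (simp add: \<beta>\<gamma> scaleR_diff_right)
  have "\<beta> \<noteq> \<gamma>" using assms(4) \<beta>\<gamma> by auto
  show thesis
  proof (cases "\<beta> = 0 \<or> \<gamma> = 0")
    case False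
    then have "\<beta> - \<gamma> \<in> differences \<Phi>" using \<beta>\<gamma> \<open>\<beta> \<noteq> \<gamma>\<close> by (auto simp: differences_def)
    with xy that[of 2] show thesis by simp
  next
    case True
    then have "\<beta> - \<gamma> \<in> \<Phi>" using \<beta>\<gamma> \<open>\<beta> \<noteq> \<gamma>\<close> uminus_root by auto
    from double_root_difference[OF this] xy show thesis by (intro that[of 1 "2 *\<^sub>R (\<beta> - \<gamma>)"]) simp_all
  qed
qed

lemma greatest_improvement_unique:
  assumes "generic c" "v \<in> vertices Z" "x \<in> neighbours v" "c \<bullet> greatest_improvement c v \<le> c \<bullet> x"
  shows "x = greatest_improvement c v"
proof (rule ccontr)
  assume "x \<noteq> greatest_improvement c v"
  then obtain k d where kd: "k > 0" "d \<in> differences \<Phi>" "x - greatest_improvement c v = k *\<^sub>R d"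
    using neighbours_difference[OF assms(2,3) greatest_improvement(1)[OF assms(2)]] by metis
  have "c \<bullet> (x - greatest_improvement c v) = 0"
    using assms(4) greatest_improvement(2)[OF assms(2,3), of c] by (simp add: inner_diff_right)
  with kd assms(1) show False by (simp add: generic_def)
qed

text \<open>The signs on root differences fix the order of the neighbours, and \<open>c\<close>
  strictly reverses none of the signs of \<open>c\<^sub>0\<close>.\<close>

lemma greatest_improvement_agree:
  assumes "generic c\<^sub>0" "\<And>d. d \<in> differences \<Phi> \<Longrightarrow> c\<^sub>0 \<bullet> d > 0 \<Longrightarrow> c \<bullet> d \<ge> 0"
    and v: "v \<in> vertices Z" "x \<in> neighbours v"
  shows "c \<bullet> x \<le> c \<bullet> greatest_improvement c\<^sub>0 v"
proof (cases "greatest_improvement c\<^sub>0 v = x")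
  case False
  then obtain k d where kd: "k > 0" "d \<in> differences \<Phi>" "greatest_improvement c\<^sub>0 v - x = k *\<^sub>R d"
    using neighbours_difference[OF v(1) greatest_improvement(1)[OF v(1)] v(2)] by metis
  have "c\<^sub>0 \<bullet> (greatest_improvement c\<^sub>0 v - x) \<ge> 0"
    using greatest_improvement(2)[OF v] by (simp add: inner_diff_right)
  then have "c\<^sub>0 \<bullet> d \<ge> 0" using kd by (simp add: zero_le_mult_iff)
  moreover have "c\<^sub>0 \<bullet> d \<noteq> 0" using assms(1) kd(2) by (auto simp: generic_def)
  ultimately have "c \<bullet> d \<ge> 0" using assms(2)[OF kd(2)] by linarith
  then have "c \<bullet> (greatest_improvement c\<^sub>0 v - x) \<ge> 0" using kd by simp
  then show ?thesis by (simp add: inner_diff_right)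
qed simp

text \<open>\<open>improving_wall\<close> makes every step away from \<open>top_vertex c\<close>
  strictly increasing in \<open>c\<close>, so there is no other fixed point and all iterates climb
  to it.\<close>

lemma arborescence_greatest_improvement:
  assumes c: "generic c"
  shows "arborescence Z (greatest_improvement c)"
proof -
  let ?r = "top_vertex c" and ?B = "greatest_improvement c"
  have reg: "regular c" using c by (rule generic_imp_regular)
  have r: "?r \<in> vertices Z" using reg by (auto simp: vertices_Z)
  have maps: "?B \<in> vertices Z \<rightarrow> vertices Z"
    using greatest_improvement(1) neighbours_vertices by blast
  have "?B ?r \<in> Z" using maps r by (auto simp: vertices_def extreme_point_of_def)
  then have "c \<bullet> ?B ?r \<le> c \<bullet> ?r" using maximizes_top_vertex[of c] by (simp add: maximizes_def)
  then have fix_r: "?B ?r = ?r"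
    using greatest_improvement_unique[OF c r, of ?r] by (simp add: neighbours_def)
  have inc: "c \<bullet> v < c \<bullet> ?B v" if v: "v \<in> vertices Z" "v \<noteq> ?r" for v
  proof -
    obtain f where f: "regular f" "v = top_vertex f" using v(1) by (auto simp: vertices_Z)
    obtain \<delta> where \<delta>: "wall f \<delta>" "c \<bullet> \<delta> > 0" using improving_wall[OF f(1) reg] f(2) v(2) by metis
    have "v + 2 *\<^sub>R \<delta> \<in> neighbours v"
      using \<delta>(1) unfolding f(2) neighbours_top_vertex[OF f(1)] by (auto simp: step_def)
    from greatest_improvement(2)[OF v(1) this, of c] \<delta>(2) show ?thesis by (simp add: inner_add_right)
  qed
  show ?thesis
    unfolding arborescence_def
  proof (intro conjI exI[of _ ?r] ballI maps)
    show "{v \<in> vertices Z. ?B v = v} = {?r}" using inc fix_r r by force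
  next
    fix v assume v: "v \<in> vertices Z - {?r}"
    with inc have "?B v \<noteq> v" by force
    with greatest_improvement(1)[of v c] v show "adjacent Z (?B v) v" by (auto simp: neighbours_def)
  next
    fix v assume v: "v \<in> vertices Z"
    show "\<exists>k. (?B ^^ k) v = ?r"
      by (rule funpow_reaches_by_increase[where \<phi> = "\<lambda>x. c \<bullet> x", OF finite_vertices maps inc v])
  qed
qed

section \<open>Optimal arborescences and their normal cones\<close>

definition arborescence_sum :: "('a \<Rightarrow> 'a) \<Rightarrow> 'a" where
  "arborescence_sum B = (\<Sum>v\<in>vertices Z. B v - v)"

abbreviation "arborescence_sums \<equiv> arborescence_sum ` {B. arborescence Z B}"

lemma GI_neighbotope_eq: "GI_neighbotope Z = convex hull arborescence_sums"
proof -
  have "{(\<Sum>v\<in>vertices Z. B v - v) | B. arborescence Z B} = arborescence_sums"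
    unfolding arborescence_sum_def by blast
  then show ?thesis by (simp add: GI_neighbotope_def)
qed

lemma arborescence_neighbours:
  assumes "arborescence Z B" "v \<in> vertices Z"
  shows "B v \<in> neighbours v"
  using assms by (auto simp: arborescence_def neighbours_def)

lemma finite_arborescence_sums: "finite arborescence_sums"
proof -
  let ?F = "vertices Z \<rightarrow>\<^sub>E vertices Z"
  have "finite ?F" by (intro finite_PiE finite_vertices)
  moreover have "arborescence_sums \<subseteq> arborescence_sum ` ?F"
  proof
    fix x assume "x \<in> arborescence_sums"
    then obtain B where B: "arborescence Z B" "x = arborescence_sum B" by blast
    \<comment> \<open>Values off the vertex set are unconstrained, so finiteness is only visible
      after restricting, which does not change the sum.\<close>
    then have "restrict B (vertices Z) \<in> ?F" by (auto simp: arborescence_def)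
    moreover have "x = arborescence_sum (restrict B (vertices Z))"
      unfolding B(2) arborescence_sum_def by (intro sum.cong) auto
    ultimately show "x \<in> arborescence_sum ` ?F" by blast
  qed
  ultimately show ?thesis by (meson finite_imageI finite_subset)
qed

lemma maximizes_arborescence_sum:
  assumes "generic c\<^sub>0" "\<And>d. d \<in> differences \<Phi> \<Longrightarrow> c\<^sub>0 \<bullet> d > 0 \<Longrightarrow> c \<bullet> d \<ge> 0"
  shows "maximizes (GI_neighbotope Z) c (arborescence_sum (greatest_improvement c\<^sub>0))"
  unfolding GI_neighbotope_eq
proof (rule maximizes_hull)
  have "c \<bullet> arborescence_sum B \<le> c \<bullet> arborescence_sum (greatest_improvement c\<^sub>0)" if "arborescence Z B" for B
    unfolding arborescence_sum_def inner_sum_right inner_diff_right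
    using greatest_improvement_agree[OF assms _ arborescence_neighbours[OF that]]
    by (intro sum_mono) simp
  then show "maximizes arborescence_sums c (arborescence_sum (greatest_improvement c\<^sub>0))"
    using arborescence_greatest_improvement[OF assms(1)] by (auto simp: maximizes_def)
qed

text \<open>The greatest improvement dominates in every summand, so equal totals force equality at
  each vertex, where the maximizer is unique.\<close>

lemma optimal_arborescence_unique:
  assumes c: "generic c" and B: "arborescence Z B" and v: "v \<in> vertices Z"
    and opt: "c \<bullet> arborescence_sum (greatest_improvement c) \<le> c \<bullet> arborescence_sum B"
  shows "B v = greatest_improvement c v"
proof -
  have le: "c \<bullet> B u \<le> c \<bullet> greatest_improvement c u" if "u \<in> vertices Z" for u
    using greatest_improvement(2)[OF that arborescence_neighbours[OF B that]] .
  have "(\<Sum>u\<in>vertices Z. c \<bullet> greatest_improvement c u - c \<bullet> B u) \<le> 0"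
    using opt by (simp add: arborescence_sum_def inner_sum_right inner_diff_right sum_subtractf)
  moreover have "c \<bullet> greatest_improvement c v - c \<bullet> B v \<le> (\<Sum>u\<in>vertices Z. c \<bullet> greatest_improvement c u - c \<bullet> B u)"
    by (rule member_le_sum) (use v le finite_vertices in auto)
  ultimately have "c \<bullet> greatest_improvement c v \<le> c \<bullet> B v" by linarith
  from greatest_improvement_unique[OF c v arborescence_neighbours[OF B v] this] show ?thesis .
qed

text \<open>If \<open>c\<close> reverses \<open>d = \<alpha> - \<beta>\<close>, the normal cone crosses the hyperplane orthogonal to \<open>d\<close>, and
  does so at some \<open>e\<close> lying on no other relevant hyperplane. On both sides of \<open>e\<close> the same
  arborescence is optimal, although its choice at a vertex with tied best neighbours must change.\<close>

lemma normal_cone_arborescence_sum: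
  assumes c0: "generic c\<^sub>0"
    and max: "maximizes (GI_neighbotope Z) c (arborescence_sum (greatest_improvement c\<^sub>0))"
    and d: "d \<in> differences \<Phi>" "c\<^sub>0 \<bullet> d > 0"
  shows "c \<bullet> d \<ge> 0"
proof (rule ccontr)
  assume "\<not> c \<bullet> d \<ge> 0"
  then have cd: "c \<bullet> d < 0" by simp
  define p where "p = arborescence_sum (greatest_improvement c\<^sub>0)"
  note arb0 = arborescence_greatest_improvement[OF c0]
  obtain \<alpha> \<beta> where \<alpha>\<beta>: "\<alpha> \<in> \<Phi>" "\<beta> \<in> \<Phi>" "\<beta> \<noteq> \<alpha>" "d = \<alpha> - \<beta>"
    using d(1) by (auto simp: differences_def)
  have dd: "d \<bullet> d > 0" using \<alpha>\<beta>(3,4) by simp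
  define H where "H = {x. x \<bullet> d = 0}"
  have "subspace H" by (auto simp: H_def subspace_def inner_add_left)
  \<comment> \<open>The combination of \<open>c\<^sub>0\<close> and \<open>c\<close> with positive
    coefficients that is orthogonal to \<open>d\<close>.\<close>
  define e\<^sub>0 where "e\<^sub>0 = (- (c \<bullet> d)) *\<^sub>R c\<^sub>0 + (c\<^sub>0 \<bullet> d) *\<^sub>R c"
  have "e\<^sub>0 \<in> H" by (simp add: e\<^sub>0_def H_def inner_diff_left)
  \<comment> \<open>Strict optimality of \<open>p\<close> for \<open>c\<^sub>0\<close> and weak
    optimality for \<open>c\<close> add up to strict optimality, which then persists near
    \<open>e\<^sub>0\<close>.\<close>
  have pos0: "e\<^sub>0 \<bullet> (p - x) > 0" if x: "x \<in> arborescence_sums" "x \<noteq> p" for x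
  proof -
    obtain B where B: "arborescence Z B" "x = arborescence_sum B" using x(1) by blast
    have "c\<^sub>0 \<bullet> p > c\<^sub>0 \<bullet> x"
    proof (rule ccontr)
      assume "\<not> c\<^sub>0 \<bullet> p > c\<^sub>0 \<bullet> x"
      then have "B v = greatest_improvement c\<^sub>0 v" if "v \<in> vertices Z" for v
        using optimal_arborescence_unique[OF c0 B(1) that] by (simp add: B(2) p_def)
      then have "x = p" by (simp add: B(2) p_def arborescence_sum_def)
      with x(2) show False ..
    qed
    moreover have "x \<in> GI_neighbotope Z" using x(1) by (simp add: GI_neighbotope_eq hull_inc)
    then have "c \<bullet> p \<ge> c \<bullet> x" using max by (simp add: maximizes_def p_def)
    ultimately have "- (c \<bullet> d) * (c\<^sub>0 \<bullet> (p - x)) > 0" "(c\<^sub>0 \<bullet> d) * (c \<bullet> (p - x)) \<ge> 0"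
      using cd d(2) by (auto simp: inner_diff_right intro!: mult_neg_pos)
    then show ?thesis by (simp add: e\<^sub>0_def inner_diff_left)
  qed
  have "\<exists>z. \<delta> - z \<in> span {\<alpha>, \<beta>} \<and> z \<bullet> \<alpha> = 0 \<and> z \<bullet> \<beta> = 0" for \<delta>
  proof -
    obtain y z where "y \<in> span {\<alpha>, \<beta>}" "\<And>u. u \<in> span {\<alpha>, \<beta>} \<Longrightarrow> orthogonal z u" "\<delta> = y + z"
      using orthogonal_subspace_decomp_exists[of "{\<alpha>, \<beta>}" \<delta>] by metis
    then show ?thesis by (intro exI[of _ z]) (auto simp: orthogonal_def span_base)
  qed
  then obtain z where z: "\<And>\<delta>. \<delta> - z \<delta> \<in> span {\<alpha>, \<beta>} \<and> z \<delta> \<bullet> \<alpha> = 0 \<and> z \<delta> \<bullet> \<beta> = 0" by metis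
  define K where "K = (\<lambda>x. p - x) ` arborescence_sums \<union> \<Phi> \<union> differences \<Phi> \<union> z ` \<Phi>"
  have "finite K" using finite_arborescence_sums finite_roots finite_differences by (simp add: K_def)
  from exists_generic_point[OF \<open>subspace H\<close> \<open>e\<^sub>0 \<in> H\<close> \<open>finite K\<close>]
  obtain e where e: "e \<in> H" "\<And>k. k \<in> K \<Longrightarrow> e\<^sub>0 \<bullet> k \<noteq> 0 \<Longrightarrow> sgn (e \<bullet> k) = sgn (e\<^sub>0 \<bullet> k)"
    "\<And>k x. k \<in> K \<Longrightarrow> x \<in> H \<Longrightarrow> x \<bullet> k \<noteq> 0 \<Longrightarrow> e \<bullet> k \<noteq> 0" by blast
  have ed: "e \<bullet> d = 0" using e(1) by (simp add: H_def)
  have e_par: "\<exists>s. k = s *\<^sub>R d" if "k \<in> K" "e \<bullet> k = 0" for k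
    using orthogonal_to_hyperplane_parallel[of d k] e(3)[OF that(1)] that(2) by (auto simp: H_def)
  have same: "greatest_improvement c\<^sub>0 v = greatest_improvement (e + t *\<^sub>R d) v"
    if v: "v \<in> vertices Z" and t: "t \<noteq> 0"
      "\<And>k. k \<in> K \<Longrightarrow> e \<bullet> k \<noteq> 0 \<Longrightarrow> sgn ((e + t *\<^sub>R d) \<bullet> k) = sgn (e \<bullet> k)" for t v
  proof -
    have gen: "generic (e + t *\<^sub>R d)"
      unfolding generic_def
    proof
      fix k assume k: "k \<in> differences \<Phi>"
      then have "k \<in> K" by (simp add: K_def)
      show "(e + t *\<^sub>R d) \<bullet> k \<noteq> 0"
      proof (cases "e \<bullet> k = 0")
        case False
        with t(2)[OF \<open>k \<in> K\<close>] show ?thesis by (metis sgn_0_0)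
      next
        case True
        with e_par[OF \<open>k \<in> K\<close>] obtain s where s: "k = s *\<^sub>R d" by blast
        moreover have "s \<noteq> 0" using k zero_notin_differences[of \<Phi>] s by auto
        ultimately show ?thesis using dd t(1) ed by (simp add: inner_add_left)
      qed
    qed
    have "(e + t *\<^sub>R d) \<bullet> x \<le> (e + t *\<^sub>R d) \<bullet> p" if "x \<in> arborescence_sums" for x
    proof (cases "x = p")
      case False
      have "p - x \<in> K" using that by (simp add: K_def)
      have "e\<^sub>0 \<bullet> (p - x) > 0" by (rule pos0[OF that False])
      with e(2)[OF \<open>p - x \<in> K\<close>] have "sgn (e \<bullet> (p - x)) = 1" by simp
      with t(2)[OF \<open>p - x \<in> K\<close>] have "sgn ((e + t *\<^sub>R d) \<bullet> (p - x)) = 1" by (metis sgn_0 zero_neq_one)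
      then have "(e + t *\<^sub>R d) \<bullet> (p - x) > 0" by (simp only: sgn_1_pos)
      then show ?thesis unfolding inner_diff_right by linarith
    qed simp
    from this[of "arborescence_sum (greatest_improvement (e + t *\<^sub>R d))"]
      arborescence_greatest_improvement[OF gen]
    show ?thesis by (intro optimal_arborescence_unique[OF gen arb0 v]) (simp add: p_def)
  qed
  have "e \<bullet> (\<alpha> - \<beta>) = 0" using ed \<alpha>\<beta>(4) by simp
  moreover have "e \<bullet> \<delta> \<noteq> 0" if "\<delta> \<in> \<Phi>" "\<nexists>s. \<delta> = s *\<^sub>R (\<alpha> - \<beta>)" for \<delta>
    using e_par[of \<delta>] that \<alpha>\<beta>(4) by (auto simp: K_def)
  moreover have "e \<bullet> z \<delta> \<noteq> 0" if "\<delta> \<in> \<Phi>" "z \<delta> \<noteq> 0" for \<delta>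
  proof (rule e(3))
    show "z \<delta> \<in> K" using that by (simp add: K_def)
    show "z \<delta> \<in> H" using z[of \<delta>] by (simp add: H_def \<alpha>\<beta>(4) inner_diff_right)
    show "z \<delta> \<bullet> z \<delta> \<noteq> 0" using that by simp
  qed
  ultimately obtain f \<mu> \<nu> s where f: "regular f" "step f \<mu>" "step f \<nu>" "s \<noteq> 0" "\<mu> - \<nu> = s *\<^sub>R (\<alpha> - \<beta>)"
    "\<And>\<delta>. step f \<delta> \<Longrightarrow> \<delta> \<noteq> \<mu> \<Longrightarrow> \<delta> \<noteq> \<nu> \<Longrightarrow> e \<bullet> \<delta> < e \<bullet> \<mu>"
    using tied_steps[OF \<alpha>\<beta>(1-3), of e z] z by blast
  let ?v = "top_vertex f"
  have v: "?v \<in> vertices Z" using f(1) by (auto simp: vertices_Z)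
  obtain \<delta> where \<delta>: "step f \<delta>" "greatest_improvement c\<^sub>0 ?v = ?v + 2 *\<^sub>R \<delta>"
    using greatest_improvement(1)[OF v, of c\<^sub>0] unfolding neighbours_top_vertex[OF f(1)] by blast
  have best: "(e + t *\<^sub>R d) \<bullet> \<gamma> \<le> (e + t *\<^sub>R d) \<bullet> \<delta>"
    if "step f \<gamma>" "t \<noteq> 0" "\<And>k. k \<in> K \<Longrightarrow> e \<bullet> k \<noteq> 0 \<Longrightarrow> sgn ((e + t *\<^sub>R d) \<bullet> k) = sgn (e \<bullet> k)" for t \<gamma>
  proof -
    have "?v + 2 *\<^sub>R \<gamma> \<in> neighbours ?v" unfolding neighbours_top_vertex[OF f(1)] using that(1) by blast
    from greatest_improvement(2)[OF v this, of "e + t *\<^sub>R d"]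
    have "(e + t *\<^sub>R d) \<bullet> (?v + 2 *\<^sub>R \<gamma>) \<le> (e + t *\<^sub>R d) \<bullet> (?v + 2 *\<^sub>R \<delta>)"
      using same[OF v that(2,3)] \<delta>(2) by simp
    then show ?thesis unfolding inner_add_right inner_scaleR_right by simp
  qed
  obtain t where t: "t > 0" "\<And>k. k \<in> K \<Longrightarrow> e \<bullet> k \<noteq> 0 \<Longrightarrow> sgn ((e + t *\<^sub>R d) \<bullet> k) = sgn (e \<bullet> k)"
    using exists_sgn_inner_perturb[OF \<open>finite K\<close>, of e d] by metis
  obtain u where u: "u > 0" "\<And>k. k \<in> K \<Longrightarrow> e \<bullet> k \<noteq> 0 \<Longrightarrow> sgn ((e + u *\<^sub>R (- d)) \<bullet> k) = sgn (e \<bullet> k)"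
    using exists_sgn_inner_perturb[OF \<open>finite K\<close>, of e "- d"] by metis
  have up: "e \<bullet> \<gamma> + t * (d \<bullet> \<gamma>) \<le> e \<bullet> \<delta> + t * (d \<bullet> \<delta>)" if "step f \<gamma>" for \<gamma>
    using best[OF that, of t] t by (simp add: inner_add_left)
  have down: "e \<bullet> \<gamma> - u * (d \<bullet> \<gamma>) \<le> e \<bullet> \<delta> - u * (d \<bullet> \<delta>)" if "step f \<gamma>" for \<gamma>
    using best[OF that, of "- u"] u by (simp add: inner_diff_left)
  \<comment> \<open>Weighting the two inequalities by \<open>u\<close> and \<open>t\<close> cancels
    the terms in \<open>d\<close>.\<close>
  have "(t + u) * (e \<bullet> \<mu>) \<le> (t + u) * (e \<bullet> \<delta>)"
    using mult_left_mono[OF up[OF f(2)], of u] mult_left_mono[OF down[OF f(2)], of t] t(1) u(1)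
    by (simp add: algebra_simps)
  then have "e \<bullet> \<mu> \<le> e \<bullet> \<delta>" using t(1) u(1) by (simp add: mult_le_cancel_left)
  with f(6)[OF \<delta>(1)] have "\<delta> = \<mu> \<or> \<delta> = \<nu>" by force
  have "e \<bullet> (\<mu> - \<nu>) = 0" "d \<bullet> (\<mu> - \<nu>) = s * (d \<bullet> d)"
    using ed by (simp_all add: f(5) \<alpha>\<beta>(4)[symmetric])
  then have tie: "e \<bullet> \<mu> = e \<bullet> \<nu>" and "d \<bullet> \<mu> \<noteq> d \<bullet> \<nu>"
    using f(4) dd by (auto simp: inner_diff_right)
  \<comment> \<open>Both tied steps have equal value at \<open>e\<close>, so the two sides of the
    hyperplane bound \<open>d \<bullet> \<gamma>\<close> from above and from below by
    \<open>d \<bullet> \<delta>\<close>.\<close>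
  have "t * (d \<bullet> \<gamma>) \<le> t * (d \<bullet> \<delta>) \<and> u * (d \<bullet> \<delta>) \<le> u * (d \<bullet> \<gamma>)" if "\<gamma> = \<mu> \<or> \<gamma> = \<nu>" for \<gamma>
    using up[of \<gamma>] down[of \<gamma>] f(2,3) that \<open>\<delta> = \<mu> \<or> \<delta> = \<nu>\<close> tie by auto
  then have "d \<bullet> \<gamma> = d \<bullet> \<delta>" if "\<gamma> = \<mu> \<or> \<gamma> = \<nu>" for \<gamma>
    using that t(1) u(1) by (force simp: mult_le_cancel_left)
  then have "d \<bullet> \<mu> = d \<bullet> \<nu>" by metis
  with \<open>d \<bullet> \<mu> \<noteq> d \<bullet> \<nu>\<close> show False ..
qed

section \<open>The fan of the neighbotope and the comparison with sweep polytopes\<close>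

lemma GI_neighbotope_fan: "has_arrangement_fan (GI_neighbotope Z) (differences \<Phi>)"
  unfolding has_arrangement_fan_def
proof (intro allI impI)
  fix c\<^sub>0 assume "\<forall>d\<in>differences \<Phi>. c\<^sub>0 \<bullet> d \<noteq> 0"
  then have c0: "generic c\<^sub>0" by (simp add: generic_def)
  show "\<exists>p\<in>GI_neighbotope Z. \<forall>c. maximizes (GI_neighbotope Z) c p \<longleftrightarrow>
      (\<forall>d\<in>differences \<Phi>. c\<^sub>0 \<bullet> d > 0 \<longrightarrow> c \<bullet> d \<ge> 0)"
  proof (intro bexI allI iffI ballI impI)
    show "arborescence_sum (greatest_improvement c\<^sub>0) \<in> GI_neighbotope Z"
      using maximizes_arborescence_sum[OF c0, of c\<^sub>0] by (simp add: maximizes_def)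
  qed (use maximizes_arborescence_sum[OF c0] normal_cone_arborescence_sum[OF c0] in blast)+
qed

lemma polytope_GI_neighbotope: "polytope (GI_neighbotope Z)" "GI_neighbotope Z \<noteq> {}"
proof -
  show "polytope (GI_neighbotope Z)"
    unfolding GI_neighbotope_eq by (rule polytope_convex_hull[OF finite_arborescence_sums])
  from exists_generic_point[OF subspace_UNIV UNIV_I finite_differences[OF finite_roots], of 0]
  obtain c where c: "\<And>d x. d \<in> differences \<Phi> \<Longrightarrow> x \<bullet> d \<noteq> 0 \<Longrightarrow> c \<bullet> d \<noteq> 0" by blast
  have "generic c"
    unfolding generic_def
  proof
    fix d assume "d \<in> differences \<Phi>"
    with zero_notin_differences[of \<Phi>] c[of d d] show "c \<bullet> d \<noteq> 0" by auto
  qed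
  from maximizes_arborescence_sum[OF this, of c] show "GI_neighbotope Z \<noteq> {}"
    by (auto simp: maximizes_def)
qed

text \<open>A generic point of the hyperplane orthogonal to a root \<gamma> is an edge normal for
  it, so every root occurs. The segments of \<gamma> and -\<gamma> together give an edge of length
  twice that of \<gamma>.\<close>

lemma edge_directions_Z: "edge_directions Z = (*\<^sub>R) 2 ` \<Phi>"
proof (intro equalityI subsetI)
  fix x assume "x \<in> edge_directions Z"
  then obtain a \<gamma> where "edge_normal a \<gamma>" "x = top_vertex a + \<gamma> - (top_vertex a - \<gamma>)"
    by (auto simp: edge_directions_def adjacent_Z_iff)
  then show "x \<in> (*\<^sub>R) 2 ` \<Phi>" by (auto simp: edge_normal_def scaleR_2)
next
  fix x assume "x \<in> (*\<^sub>R) 2 ` \<Phi>"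
  then obtain \<gamma> where \<gamma>: "\<gamma> \<in> \<Phi>" "x = 2 *\<^sub>R \<gamma>" by blast
  have "subspace {a. a \<bullet> \<gamma> = 0}" by (auto simp: subspace_def inner_add_left)
  from exists_generic_point[OF this _ finite_roots, of 0]
  obtain a where a: "a \<bullet> \<gamma> = 0" "\<And>k y. k \<in> \<Phi> \<Longrightarrow> y \<bullet> \<gamma> = 0 \<Longrightarrow> y \<bullet> k \<noteq> 0 \<Longrightarrow> a \<bullet> k \<noteq> 0"
    by auto
  have "a \<bullet> \<alpha> \<noteq> 0" if \<alpha>: "\<alpha> \<in> \<Phi> - {\<gamma>, - \<gamma>}" for \<alpha>
  proof
    assume "a \<bullet> \<alpha> = 0"
    with a(2)[of \<alpha>] \<alpha> obtain s where "\<alpha> = s *\<^sub>R \<gamma>"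
      using orthogonal_to_hyperplane_parallel[of \<gamma> \<alpha>] by blast
    with parallel_root[OF \<gamma>(1), of s] \<alpha> show False by auto
  qed
  with a(1) \<gamma>(1) have "edge_normal a \<gamma>" by (simp add: edge_normal_def)
  then have "adjacent Z (top_vertex a + \<gamma>) (top_vertex a - \<gamma>)" by (auto simp: adjacent_Z_iff)
  moreover have "x = (top_vertex a + \<gamma>) - (top_vertex a - \<gamma>)" by (simp add: \<gamma>(2) scaleR_2)
  ultimately show "x \<in> edge_directions Z" unfolding edge_directions_def by blast
qed

text \<open>Scaling the roots scales their differences and keeps the arrangement. The factor 2
  covers the edge directions and the factor 1 the roots themselves.\<close>

lemma GI_neighbotope_normally_equivalent_sweep_polytope:
  assumes "k > 0"
  shows "normally_equivalent (GI_neighbotope Z) (sweep_polytope ((*\<^sub>R) k ` \<Phi>))"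
proof (rule normally_equivalent_same_fan[OF polytope_GI_neighbotope GI_neighbotope_fan])
  have fin: "finite ((*\<^sub>R) k ` \<Phi>)" using finite_roots by simp
  show "polytope (sweep_polytope ((*\<^sub>R) k ` \<Phi>))" "sweep_polytope ((*\<^sub>R) k ` \<Phi>) \<noteq> {}"
    using sweep_polytope_fan[OF fin] by auto
  show "has_arrangement_fan (sweep_polytope ((*\<^sub>R) k ` \<Phi>)) (differences \<Phi>)"
    using sweep_polytope_fan(3)[OF fin] assms
    by (intro has_arrangement_fan_scaleR[OF assms, of _ "differences \<Phi>"]) (simp add: differences_scaleR)
  show "finite (differences \<Phi>)" "0 \<notin> differences \<Phi>"
    by (simp_all add: finite_differences finite_roots zero_notin_differences)
qed

end

theorem theorem1p8:
  fixes \<Phi> :: "(real ^ 'n) set"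
  assumes "root_system \<Phi>" and "irreducible_roots \<Phi>" and "crystallographic \<Phi>"
  shows "normally_equivalent (GI_neighbotope (coxeter_zonotope \<Phi>))
           (sweep_polytope (edge_directions (coxeter_zonotope \<Phi>))) \<and>
         normally_equivalent (GI_neighbotope (coxeter_zonotope \<Phi>)) (sweep_polytope \<Phi>)"
proof -
  interpret crystallographic_roots \<Phi> using assms(1,3) by unfold_locales
  show ?thesis
    using GI_neighbotope_normally_equivalent_sweep_polytope[of 2]
      GI_neighbotope_normally_equivalent_sweep_polytope[of 1]
    by (simp add: edge_directions_Z)
qed

end
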